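(* Let $\mathfrak F$ be a non-empty formation of finite groups, and let $\mathfrak X$ be a class of simple groups such that $\mathrm{Char}(\mathfrak X)=\pi(\mathfrak X)$. Let $\mathfrak L$ be a class of simple groups such that $\mathfrak L^+=\mathfrak X^+$. (1) If $\mathfrak F$ is an $\mathfrak X$-local formation, then $\mathfrak F$ has an $\mathfrak L$-composition satellite. (2) If $\mathfrak F$ has an $\mathfrak L$-composition satellite, then $\mathfrak F$ is an $\mathfrak X^+$-local formation.
   Context: All groups are finite; classes of groups are closed under isomorphism. A formation is a class of groups closed under homomorphic images and subdirect products (the empty class is allowed as a formation). $\mathfrak J$ is the class of all simple groups (abelian and non-abelian). For a class $\mathfrak L\subseteq\mathfrak J$: $\mathfrak L'=\mathfrak J\setminus\mathfrak L$, $\mathfrak L^+$ is the class of all abelian groups in $\mathfrak L$. $\mathrm{Com}(G)$ is the class of all simple groups isomorphic to composition factors of $G$. $\mathrm E\mathfrak L$ is the class of all groups $G$ with $\mathrm{Com}(G)\subseteq\mathfrak L$. $\mathrm{Char}(\mathfrak X)$ is the set of orders of abelian simple groups in $\mathfrak X$; $\pi(H)$ is the set of primes dividing $|H|$ and $\pi(\mathfrak X)=\bigcup_{G\in\mathfrak X}\pi(G)$. $C_G(H/K)$ is the centralizer in $G$ of a chief factor $H/K$; an $\mathrm E\mathfrak L$-chief factor is one belonging to $\mathrm E\mathfrak L$. $\mathrm{Soc}(G)$ is the product of all minimal normal subgroups; a group is monolithic if it has a unique minimal normal subgroup. $\mathfrak X$-local formation (for $\mathfrak X\subseteq\mathfrak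 J$ with $\mathrm{Char}(\mathfrak X)=\pi(\mathfrak X)$): let $f:\pi(\mathfrak X)\cup\mathfrak X'\to\{\text{formations}\}$ be a map taking equal values on isomorphic groups. $LF_{\mathfrak X}(f)$ is the class of all groups $G$ such that (i) if $H/K$ is a chief $\mathrm E\mathfrak X$-factor of $G$, then $G/C_G(H/K)\in f(p)$ for every $p\in\pi(H/K)$; and (ii) if $G/L$ is a monolithic quotient of $G$ with $\mathrm{Soc}(G/L)\in\mathrm E(\mathfrak X')$, then $G/L\in f(S)$ where $S\in\mathrm{Com}(\mathrm{Soc}(G/L))$. A formation is $\mathfrak X$-local if it equals $LF_{\mathfrak X}(f)$ for some such $f$. ($\mathfrak X^+$-local means the same with $\mathfrak X$ replaced by $\mathfrak X^+$.) $\mathfrak L$-composition satellite: a map $f$ from finite groups to formations (possibly empty) that takes equal values on non-identity groups having the same set (up to isomorphism) of composition factors, and takes one common value, denoted $f(\mathfrak L')$, on all non-identity $\mathrm E(\mathfrak L')$-groups (if $\mathfrak L'\neq\varnothing$). The small centralizer $c_G(H/K)$ of a chief factor $H/K$ of $G$ is the subgroup generated by all normal subgroups $N$ of $G$ with $\mathrm{Com}(NK/K)\cap\mathrm{Com}(H/K)=\varnothing$. A chief factor $H/K$ of $G$ is $f$-central if either $H/K\in\mathrm E\mathfrak L$ and $G/C_G(H/K)\in f(H/K)$, or $H/K\in\mathrm E(\mathfrak L')$ and $G/c_G(H/K)\in f(\mathfrak L')$. $CF_{\mathfrak L}(f)$ is the class of all groups all of whose chief factors are $f$-central (it contains the identity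 group by definition). A formation $\mathfrak F$ has an $\mathfrak L$-composition satellite if $\mathfrak F=CF_{\mathfrak L}(f)$ for some $\mathfrak L$-composition satellite $f$. *)

theory Defs
  imports "HOL-Algebra.SimpleGroups" "HOL-Algebra.Product_Groups"
begin

section \<open>Classes of finite groups\<close>

text \<open>
  Every finite group is isomorphic to one whose elements are natural numbers, so a class of finite
  groups is represented by an isomorphism-closed set of groups over \<^typ>\<open>nat\<close>. Groups over
  other types (quotients, sections, products) belong to the class via an isomorphic copy.
\<close>

type_synonym grp_class = "nat monoid set"

definition finite_groups :: grp_class where
  "finite_groups = {G. group G \<and> finite (carrier G)}"

definition group_class :: "grp_class \<Rightarrow> bool" where
  "group_class F \<longleftrightarrow> F \<subseteq> finite_groups \<and> (\<forall>G\<in>F. \<forall>H. group H \<and> G \<cong> H \<longrightarrow> H \<in> F)"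

definition belongs :: "('a, 'b) monoid_scheme \<Rightarrow> grp_class \<Rightarrow> bool" (infix \<open>\<in>\<^sub>c\<close> 50) where
  "G \<in>\<^sub>c F \<longleftrightarrow> (\<exists>H\<in>F. G \<cong> H)"

definition nat_copy :: "('a, 'b) monoid_scheme \<Rightarrow> nat monoid" where
  "nat_copy G = (SOME H. group H \<and> G \<cong> H)"

lemma belongs_iff_mem:
  assumes "group_class F" "group (G :: nat monoid)"
  shows "G \<in>\<^sub>c F \<longleftrightarrow> G \<in> F"
proof
  assume "G \<in>\<^sub>c F"
  then obtain H where H: "H \<in> F" "G \<cong> H" by (auto simp: belongs_def)
  then have "H \<cong> G" using group.iso_sym[OF assms(2)] by blast
  then show "G \<in> F" using assms H(1) by (auto simp: group_class_def)
next
  assume "G \<in> F"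
  then show "G \<in>\<^sub>c F" using iso_refl[of G] unfolding belongs_def by blast
qed

lemma nat_copy:
  assumes "group G" "finite (carrier G)"
  shows "group (nat_copy G)" "G \<cong> nat_copy G"
proof -
  interpret group G by fact
  obtain h :: "'a \<Rightarrow> nat" where h: "inj_on h (carrier G)"
    using finite_imp_inj_to_nat_seg[OF assms(2)] by blast
  define g where "g = inv_into (carrier G) h"
  define H where "H = \<lparr>carrier = h ` carrier G, monoid.mult = (\<lambda>x y. h (g x \<otimes>\<^bsub>G\<^esub> g y)), one = h \<one>\<^bsub>G\<^esub>\<rparr>"
  have gh: "g (h x) = x" if "x \<in> carrier G" for x using h that by (simp add: g_def)
  have "group H"
  proof (rule groupI)
    fix x assume "x \<in> carrier H"
    then obtain a where "a \<in> carrier G" "x = h a" by (auto simp: H_def)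
    then show "\<exists>y\<in>carrier H. y \<otimes>\<^bsub>H\<^esub> x = \<one>\<^bsub>H\<^esub>"
      by (intro bexI[of _ "h (inv\<^bsub>G\<^esub> a)"]) (auto simp: H_def gh)
  qed (auto simp: H_def gh m_assoc)
  moreover have "h \<in> iso G H" using h by (auto simp: iso_def hom_def bij_betw_def H_def gh)
  ultimately have "\<exists>H :: nat monoid. group H \<and> G \<cong> H" by (auto simp: is_iso_def)
  then have "group (nat_copy G) \<and> G \<cong> nat_copy G" unfolding nat_copy_def by (rule someI_ex)
  then show "group (nat_copy G)" "G \<cong> nat_copy G" by auto
qed

text \<open>
  Subdirect products are taken over nonempty finite index sets, so that the empty class is a
  formation.
\<close>

definition formation :: "grp_class \<Rightarrow> bool" where
  "formation F \<longleftrightarrow> group_class F \<and>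
     (\<forall>G\<in>F. \<forall>(H :: nat monoid) h. group H \<and> h \<in> epi G H \<longrightarrow> H \<in> F) \<and>
     (\<forall>(I :: nat set) G S. finite I \<and> I \<noteq> {} \<and> (\<forall>i\<in>I. G i \<in> F) \<and>
        subgroup S (product_group I G) \<and> (\<forall>i\<in>I. (\<lambda>x. x i) ` S = carrier (G i))
        \<longrightarrow> (product_group I G)\<lparr>carrier := S\<rparr> \<in>\<^sub>c F)"

section \<open>Composition factors\<close>

definition factor :: "('a, 'b) monoid_scheme \<Rightarrow> 'a set \<Rightarrow> 'a set \<Rightarrow> 'a set monoid" where
  "factor G H K = G\<lparr>carrier := H\<rparr> Mod K"

definition composition_series :: "('a, 'b) monoid_scheme \<Rightarrow> 'a set list \<Rightarrow> bool" where
  "composition_series G Hs \<longleftrightarrow> Hs \<noteq> [] \<and> hd Hs = {\<one>\<^bsub>G\<^esub>} \<and> last Hs = carrier G \<and>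
     (\<forall>H\<in>set Hs. subgroup H G) \<and>
     (\<forall>i. Suc i < length Hs \<longrightarrow> Hs ! i \<lhd> G\<lparr>carrier := Hs ! Suc i\<rparr> \<and>
        simple_group (factor G (Hs ! Suc i) (Hs ! i)))"

definition simple_groups :: grp_class  (\<open>\<JJ>\<close>) where
  "\<JJ> = {S \<in> finite_groups. simple_group S}"

definition Com :: "('a, 'b) monoid_scheme \<Rightarrow> grp_class" where
  "Com G = {S \<in> \<JJ>. \<exists>Hs i. composition_series G Hs \<and> Suc i < length Hs \<and>
                         S \<cong> factor G (Hs ! Suc i) (Hs ! i)}"

definition simple_class :: "grp_class \<Rightarrow> bool" where
  "simple_class L \<longleftrightarrow> group_class L \<and> L \<subseteq> \<JJ>"

definition compl_class :: "grp_class \<Rightarrow> grp_class" where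
  "compl_class L = \<JJ> - L"

definition abelian_part :: "grp_class \<Rightarrow> grp_class" where
  "abelian_part L = {S \<in> L. comm_group S}"

definition Ecl :: "grp_class \<Rightarrow> grp_class" where
  "Ecl L = {G \<in> finite_groups. Com G \<subseteq> L}"

definition primes_of :: "('a, 'b) monoid_scheme \<Rightarrow> nat set" where
  "primes_of G = {p. prime p \<and> p dvd order G}"

definition primes_of_class :: "grp_class \<Rightarrow> nat set" where
  "primes_of_class X = (\<Union>G\<in>X. primes_of G)"

definition char_primes :: "grp_class \<Rightarrow> nat set" where
  "char_primes X = {order S | S. S \<in> X \<and> simple_group S \<and> comm_group S}"

section \<open>Chief factors\<close>

definition chief_factor :: "('a, 'b) monoid_scheme \<Rightarrow> 'a set \<Rightarrow> 'a set \<Rightarrow> bool" where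
  "chief_factor G H K \<longleftrightarrow> H \<lhd> G \<and> K \<lhd> G \<and> K \<subset> H \<and>
     (\<forall>N. N \<lhd> G \<and> K \<subseteq> N \<and> N \<subseteq> H \<longrightarrow> N = K \<or> N = H)"

text \<open>
  The elements of \<open>G\<close> acting trivially by conjugation on \<open>H/K\<close>.
\<close>

definition centralizer :: "('a, 'b) monoid_scheme \<Rightarrow> 'a set \<Rightarrow> 'a set \<Rightarrow> 'a set" where
  "centralizer G H K =
     {g \<in> carrier G. \<forall>h\<in>H. K #>\<^bsub>G\<^esub> (g \<otimes>\<^bsub>G\<^esub> h \<otimes>\<^bsub>G\<^esub> inv\<^bsub>G\<^esub> g) = K #>\<^bsub>G\<^esub> h}"

definition small_centralizer :: "('a, 'b) monoid_scheme \<Rightarrow> 'a set \<Rightarrow> 'a set \<Rightarrow> 'a set" where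
  "small_centralizer G H K =
     generate G (\<Union>{N. N \<lhd> G \<and> Com (factor G (N <#>\<^bsub>G\<^esub> K) K) \<inter> Com (factor G H K) = {}})"

definition minimal_normal :: "'a set \<Rightarrow> ('a, 'b) monoid_scheme \<Rightarrow> bool" where
  "minimal_normal N G \<longleftrightarrow> N \<lhd> G \<and> N \<noteq> {\<one>\<^bsub>G\<^esub>} \<and>
     (\<forall>M. M \<lhd> G \<and> M \<subseteq> N \<longrightarrow> M = {\<one>\<^bsub>G\<^esub>} \<or> M = N)"

definition Soc :: "('a, 'b) monoid_scheme \<Rightarrow> 'a set" where
  "Soc G = generate G (\<Union>{N. minimal_normal N G})"

definition monolithic :: "('a, 'b) monoid_scheme \<Rightarrow> bool" where
  "monolithic G \<longleftrightarrow> (\<exists>!N. minimal_normal N G)"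

section \<open>Local formations relative to a class of simple groups\<close>

text \<open>
  A function on \<open>\<pi>(X) \<union> X'\<close> is modelled on a sum type: primes are tagged with \<^const>\<open>Inl\<close>,
  simple groups with \<^const>\<open>Inr\<close>. Values off the domain are irrelevant.
\<close>

definition local_function :: "grp_class \<Rightarrow> (nat + nat monoid \<Rightarrow> grp_class) \<Rightarrow> bool" where
  "local_function X f \<longleftrightarrow>
     (\<forall>a \<in> primes_of_class X <+> compl_class X. formation (f a)) \<and>
     (\<forall>S\<in>compl_class X. \<forall>T\<in>compl_class X. S \<cong> T \<longrightarrow> f (Inr S) = f (Inr T))"

definition LF :: "grp_class \<Rightarrow> (nat + nat monoid \<Rightarrow> grp_class) \<Rightarrow> grp_class" where
  "LF X f = {G \<in> finite_groups.
     (\<forall>H K. chief_factor G H K \<and> factor G H K \<in>\<^sub>c Ecl X \<longrightarrow>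
        (\<forall>p\<in>primes_of (factor G H K). G Mod centralizer G H K \<in>\<^sub>c f (Inl p))) \<and>
     (\<forall>N. N \<lhd> G \<and> monolithic (G Mod N) \<and>
          (G Mod N)\<lparr>carrier := Soc (G Mod N)\<rparr> \<in>\<^sub>c Ecl (compl_class X) \<longrightarrow>
        (\<forall>S\<in>Com ((G Mod N)\<lparr>carrier := Soc (G Mod N)\<rparr>). G Mod N \<in>\<^sub>c f (Inr S)))}"

definition local_formation :: "grp_class \<Rightarrow> grp_class \<Rightarrow> bool" where
  "local_formation X F \<longleftrightarrow> formation F \<and> (\<exists>f. local_function X f \<and> F = LF X f)"

section \<open>Composition satellites\<close>

definition nonidentity :: "nat monoid \<Rightarrow> bool" where
  "nonidentity G \<longleftrightarrow> carrier G \<noteq> {\<one>\<^bsub>G\<^esub>}"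

definition composition_satellite :: "grp_class \<Rightarrow> (nat monoid \<Rightarrow> grp_class) \<Rightarrow> bool" where
  "composition_satellite L f \<longleftrightarrow>
     (\<forall>G\<in>finite_groups. formation (f G)) \<and>
     (\<forall>G\<in>finite_groups. \<forall>H\<in>finite_groups.
        nonidentity G \<and> nonidentity H \<and> Com G = Com H \<longrightarrow> f G = f H) \<and>
     (\<forall>G\<in>Ecl (compl_class L). \<forall>H\<in>Ecl (compl_class L).
        nonidentity G \<and> nonidentity H \<longrightarrow> f G = f H)"

text \<open>
  The common value \<open>f(L')\<close>; it is only meaningful (and only used) if \<open>L'\<close> is nonempty.
\<close>

definition compl_value :: "grp_class \<Rightarrow> (nat monoid \<Rightarrow> grp_class) \<Rightarrow> grp_class" where
  "compl_value L f = (THE A. \<forall>G\<in>Ecl (compl_class L). nonidentity G \<longrightarrow> f G = A)"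

text \<open>
  The value of a satellite at \<open>H/K\<close> is taken at an isomorphic copy over \<^typ>\<open>nat\<close>. For
  nonidentity groups it does not depend on the copy, as isomorphic groups have the same
  composition factors.
\<close>

definition f_central ::
  "grp_class \<Rightarrow> (nat monoid \<Rightarrow> grp_class) \<Rightarrow> ('a, 'b) monoid_scheme \<Rightarrow> 'a set \<Rightarrow> 'a set \<Rightarrow> bool" where
  "f_central L f G H K \<longleftrightarrow>
     factor G H K \<in>\<^sub>c Ecl L \<and> G Mod centralizer G H K \<in>\<^sub>c f (nat_copy (factor G H K)) \<or>
     factor G H K \<in>\<^sub>c Ecl (compl_class L) \<and> G Mod small_centralizer G H K \<in>\<^sub>c compl_value L f"

definition CF :: "grp_class \<Rightarrow> (nat monoid \<Rightarrow> grp_class) \<Rightarrow> grp_class" where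
  "CF L f = {G \<in> finite_groups. \<forall>H K. chief_factor G H K \<longrightarrow> f_central L f G H K}"

definition has_composition_satellite :: "grp_class \<Rightarrow> grp_class \<Rightarrow> bool" where
  "has_composition_satellite L F \<longleftrightarrow>
     formation F \<and> (\<exists>f. composition_satellite L f \<and> F = CF L f)"

end

theory Submission
  imports Defs "HOL-Algebra.SndIsomorphismGrp" "HOL-Algebra.Multiplicative_Group"
begin

text \<open>
  Both implications rest on the same principle (\<open>formation_by_monolithic_groups\<close>). Let \<open>F\<close> be a
  nonempty formation and let \<open>P\<close> be a property of finite groups inherited by epimorphic images. A
  group of least order that has \<open>P\<close> and lies outside \<open>F\<close> is not a subdirect product of two proper
  quotients, so it has a least nontrivial normal subgroup \<open>N\<close>, and \<open>G/N\<close> lies in \<open>F\<close>. The chief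
  factors of such a \<open>G\<close> are \<open>N/1\<close> and those above \<open>N\<close>, and the latter are chief factors of \<open>G/N\<close>
  with the same centralizer quotients. Hence, once \<open>G/N\<close> satisfies the conditions that define a
  local formation or a formation with a composition satellite, the only conditions left to compare
  for \<open>G\<close> are those at \<open>N\<close> (\<open>mem_LF_of_monolith\<close>, \<open>mem_CF_of_monolith\<close>).

  All composition factors of \<open>N\<close> are isomorphic to one simple group \<open>S\<close>
  (\<open>Com_minimal_normal_iso\<close>), and the conditions at \<open>N\<close> depend on \<open>S\<close> as follows.
  \<^item> If \<open>S\<close> is not in \<open>L\<close>, then the small centralizer of \<open>N\<close> is trivial, because every nontrivial
    normal subgroup contains \<open>N\<close> and so has \<open>S\<close> as a composition factor. Being central means that
    \<open>G\<close> itself lies in the value of the satellite.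
  \<^item> If \<open>S\<close> is in \<open>L\<close> and nonabelian, then the centralizer of \<open>N\<close> is trivial, since otherwise \<open>N\<close>
    would centralize itself. Again \<open>G\<close> itself has to lie in the value of the satellite.
  \<^item> If \<open>S\<close> is in \<open>L\<close> and abelian, then it is also in \<open>X\<close>, it has prime order \<open>p\<close>, and the local
    and the composition condition are both of the form: \<open>G/C\<close> lies in the value at \<open>p\<close>, where \<open>C\<close>
    is the centralizer of \<open>N\<close>.

  Suppose that a local function or a satellite defines \<open>F\<close>. The other kind of function is obtained
  by keeping the values at the primes of the abelian groups in \<open>X\<close> and assigning the value \<open>F\<close>
  elsewhere. The value \<open>F\<close> excludes no group of \<open>F\<close>, as formations are closed under quotients.
  Conversely, let \<open>G\<close> satisfy the new conditions. If \<open>S\<close> is abelian and in \<open>X\<close>, the new condition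
  at \<open>N\<close> is the old one. Otherwise the value \<open>F\<close> forces \<open>G\<close> into \<open>F\<close>: for a satellite by the first
  two cases above, and for a local function because clause (ii) in its definition, applied to \<open>G\<close>
  itself, says so.

  Composition factors are handled without comparing composition series: \<open>S\<close> is a composition factor
  of \<open>G\<close> exactly if some subnormal subgroup of \<open>G\<close> maps onto \<open>S\<close>
  (\<open>Com_iff_subnormal_epi\<close>). This description behaves well under epimorphisms, subnormal
  subgroups and extensions.
\<close>

section \<open>Epimorphisms of groups\<close>

text \<open>
  Isomorphisms, quotient maps and their composites with isomorphic copies are all instances, so that
  each invariance statement below is proved only once.
\<close>

locale group_epi = group_hom +
  assumes surj: "h ` carrier G = carrier H"

lemma group_epiI: "\<lbrakk>group G; group H; h \<in> epi G H\<rbrakk> \<Longrightarrow> group_epi G H h"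
  by (auto simp: group_epi_def group_epi_axioms_def group_hom_def group_hom_axioms_def epi_def)

lemma (in group_epi) epi: "h \<in> epi G H"
  by (simp add: epi_def surj)

lemma (in group) normal_in_subgroup_iff:
  assumes "subgroup H G"
  shows "B \<lhd> G\<lparr>carrier := H\<rparr> \<longleftrightarrow>
    subgroup B G \<and> B \<subseteq> H \<and> (\<forall>x\<in>H. \<forall>b\<in>B. x \<otimes> b \<otimes> inv x \<in> B)"
proof -
  interpret H: group "G\<lparr>carrier := H\<rparr>" using assms by (rule subgroup_imp_group)
  have "subgroup B (G\<lparr>carrier := H\<rparr>) \<longleftrightarrow> subgroup B G \<and> B \<subseteq> H"
    using incl_subgroup[OF assms] subgroup_incl[OF _ assms] subgroup.subset by fastforce
  then show ?thesis
    unfolding H.normal_inv_iff using assms m_inv_consistent[OF assms] by auto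
qed

lemma (in group_epi) restrict_epi:
  assumes "subgroup B G"
  shows "group_epi (G\<lparr>carrier := B\<rparr>) (H\<lparr>carrier := h ` B\<rparr>) h"
proof (rule group_epiI)
  show "group (G\<lparr>carrier := B\<rparr>)" by (rule G.subgroup_imp_group[OF assms])
  show "group (H\<lparr>carrier := h ` B\<rparr>)"
    by (rule H.subgroup_imp_group[OF subgroup_img_is_subgroup[OF assms]])
  show "h \<in> epi (G\<lparr>carrier := B\<rparr>) (H\<lparr>carrier := h ` B\<rparr>)"
    using subgroup.subset[OF assms] by (auto simp: epi_def hom_def subset_iff)
qed

lemma (in group_epi) subgroup_vimage:
  assumes "subgroup B H" shows "subgroup {x \<in> carrier G. h x \<in> B} G"
proof (rule G.subgroupI)
  have "\<one> \<in> {x \<in> carrier G. h x \<in> B}" using subgroup.one_closed[OF assms] by simp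
  then show "{x \<in> carrier G. h x \<in> B} \<noteq> {}" by blast
qed (simp_all add: subset_iff subgroup.m_closed[OF assms] subgroup.m_inv_closed[OF assms])

lemma (in group_epi) image_vimage:
  assumes "B \<subseteq> carrier H" shows "h ` {x \<in> carrier G. h x \<in> B} = B"
  using assms by (auto simp flip: surj)

lemma (in group_epi) mem_image_iff:
  assumes "subgroup B G" "kernel G H h \<subseteq> B" "x \<in> carrier G"
  shows "h x \<in> h ` B \<longleftrightarrow> x \<in> B"
proof
  assume "h x \<in> h ` B"
  then obtain b where b: "b \<in> B" "h x = h b" by auto
  then have bG: "b \<in> carrier G" using assms(1) by (auto dest: subgroup.subset)
  have "x \<otimes> inv b \<in> kernel G H h" using b bG assms(3) by (simp add: kernel_def)
  then have "x \<otimes> inv b \<in> B" using assms by auto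
  then have "(x \<otimes> inv b) \<otimes> b \<in> B" using b assms(1) by (auto intro: subgroup.m_closed)
  then show "x \<in> B" using assms(3) bG by (simp add: G.m_assoc)
qed auto

lemma (in group_epi) vimage_image:
  assumes "subgroup B G" "kernel G H h \<subseteq> B"
  shows "{x \<in> carrier G. h x \<in> h ` B} = B"
  using mem_image_iff[OF assms] subgroup.subset[OF assms(1)] by auto

lemma (in group_epi) normal_in_image:
  assumes "subgroup C G" "B \<lhd> G\<lparr>carrier := C\<rparr>"
  shows "h ` B \<lhd> H\<lparr>carrier := h ` C\<rparr>"
proof -
  have B: "subgroup B G" "B \<subseteq> C" "\<And>x b. x \<in> C \<Longrightarrow> b \<in> B \<Longrightarrow> x \<otimes> b \<otimes> inv x \<in> B"
    using assms G.normal_in_subgroup_iff by auto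
  have C: "C \<subseteq> carrier G" by (rule subgroup.subset[OF assms(1)])
  have "h x \<otimes>\<^bsub>H\<^esub> h b \<otimes>\<^bsub>H\<^esub> inv\<^bsub>H\<^esub> h x = h (x \<otimes> b \<otimes> inv x)" if "x \<in> C" "b \<in> B" for x b
    using that B(2) C by (simp add: subset_iff)
  then show ?thesis using B
    by (subst H.normal_in_subgroup_iff)
       (auto intro!: subgroup_img_is_subgroup assms(1) simp: image_mono)
qed

lemma (in group_epi) normal_in_vimage:
  assumes "subgroup C H" "B \<lhd> H\<lparr>carrier := C\<rparr>"
  shows "{x \<in> carrier G. h x \<in> B} \<lhd> G\<lparr>carrier := {x \<in> carrier G. h x \<in> C}\<rparr>"
proof -
  have B: "subgroup B H" "B \<subseteq> C" "\<And>x b. x \<in> C \<Longrightarrow> b \<in> B \<Longrightarrow> x \<otimes>\<^bsub>H\<^esub> b \<otimes>\<^bsub>H\<^esub> inv\<^bsub>H\<^esub> x \<in> B"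
    using assms H.normal_in_subgroup_iff by auto
  then show ?thesis
    by (subst G.normal_in_subgroup_iff) (auto intro!: subgroup_vimage assms(1))
qed

lemma (in group_epi) normal_image: "B \<lhd> G \<Longrightarrow> h ` B \<lhd> H"
  using normal_in_image[OF G.subgroup_self] by (simp add: surj)

lemma (in group_epi) normal_vimage: "B \<lhd> H \<Longrightarrow> {x \<in> carrier G. h x \<in> B} \<lhd> G"
proof -
  assume "B \<lhd> H"
  then have "{x \<in> carrier G. h x \<in> B} \<lhd> G\<lparr>carrier := {x \<in> carrier G. h x \<in> carrier H}\<rparr>"
    by (intro normal_in_vimage H.subgroup_self) simp
  moreover have "{x \<in> carrier G. h x \<in> carrier H} = carrier G" by auto
  ultimately show ?thesis by simp
qed

text \<open>
  The universal property of a surjection; all isomorphism theorems used below are consequences of it.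
\<close>

lemma (in group_epi) factor_hom:
  assumes "group_hom G K k" "kernel G H h \<subseteq> kernel G K k"
  shows "\<exists>c\<in>hom H K. \<forall>x\<in>carrier G. c (h x) = k x"
proof -
  interpret k: group_hom G K k by fact
  define c where "c y = k (SOME x. x \<in> carrier G \<and> h x = y)" for y
  have c: "c (h x) = k x" if x: "x \<in> carrier G" for x
  proof -
    define x' where "x' = (SOME x'. x' \<in> carrier G \<and> h x' = h x)"
    have x': "x' \<in> carrier G \<and> h x' = h x"
      unfolding x'_def by (rule someI[of _ x]) (simp add: x)
    have "x \<otimes> inv x' \<in> kernel G H h" using x x' by (simp add: kernel_def)
    then have "x \<otimes> inv x' \<in> kernel G K k" using assms(2) by blast
    then have "k x \<otimes>\<^bsub>K\<^esub> inv\<^bsub>K\<^esub> k x' = \<one>\<^bsub>K\<^esub>" using x x' by (simp add: kernel_def)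
    then have "k x = k x'" using x x' by (metis k.H.inv_equality k.H.inv_inv k.hom_closed k.H.inv_closed)
    then show ?thesis by (simp add: c_def x'_def)
  qed
  have "c \<in> hom H K"
  proof (rule homI)
    fix y assume "y \<in> carrier H"
    then obtain x where "x \<in> carrier G" "y = h x" using surj by auto
    then show "c y \<in> carrier K" by (simp add: c)
  next
    fix y z assume "y \<in> carrier H" "z \<in> carrier H"
    then obtain x w where "x \<in> carrier G" "y = h x" "w \<in> carrier G" "z = h w" using surj by blast
    then show "c (y \<otimes>\<^bsub>H\<^esub> z) = c y \<otimes>\<^bsub>K\<^esub> c z" using c[of "x \<otimes> w"] by (simp add: c)
  qed
  with c show ?thesis by blast
qed

lemma iso_of_equal_kernel:
  assumes "group_epi G H h" "group_epi G K k" "kernel G H h = kernel G K k"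
  shows "H \<cong> K"
proof -
  interpret h: group_epi G H h by fact
  interpret k: group_epi G K k by fact
  have "kernel G H h \<subseteq> kernel G K k" using assms(3) by simp
  from h.factor_hom[OF k.group_hom_axioms this]
  obtain c where c: "c \<in> hom H K" "\<forall>x\<in>carrier G. c (h x) = k x" by (rule bexE)
  have "c ` carrier H = carrier K"
    unfolding h.surj[symmetric] k.surj[symmetric] image_image using c(2) by (intro image_cong) auto
  moreover have "inj_on c (carrier H)"
  proof -
    interpret c: group_hom H K c using c(1) by unfold_locales
    have "y = \<one>\<^bsub>H\<^esub>" if y: "y \<in> carrier H" "c y = \<one>\<^bsub>K\<^esub>" for y
    proof -
      obtain x where "x \<in> carrier G" "y = h x" using h.surj y(1) by auto
      moreover from this have "x \<in> kernel G K k" using y c(2) by (simp add: kernel_def)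
      ultimately show ?thesis using assms(3) by (auto simp: kernel_def)
    qed
    then show ?thesis unfolding c.inj_on_one_iff by blast
  qed
  ultimately show ?thesis using c(1) by (auto simp: is_iso_def iso_def bij_betw_def)
qed

lemma quotient_epi:
  assumes "N \<lhd> G"
  shows "group_epi G (G Mod N) (\<lambda>x. N #>\<^bsub>G\<^esub> x)" "kernel G (G Mod N) (\<lambda>x. N #>\<^bsub>G\<^esub> x) = N"
proof -
  interpret normal N G by fact
  interpret Q: group "G Mod N" by (rule factorgroup_is_group)
  show "group_epi G (G Mod N) (\<lambda>x. N #>\<^bsub>G\<^esub> x)"
    by (intro group_epiI is_group Q.is_group) (simp add: epi_def r_coset_hom_Mod carrier_FactGroup)
  show "kernel G (G Mod N) (\<lambda>x. N #>\<^bsub>G\<^esub> x) = N"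
    unfolding kernel_def one_FactGroup
    using coset_join1[OF _ _ subgroup_axioms] coset_join2[OF _ subgroup_axioms] by auto
qed

lemma iso_epi:
  assumes "group G" "group H" "G \<cong> H"
  obtains h where "group_epi G H h" "kernel G H h = {\<one>\<^bsub>G\<^esub>}"
proof -
  obtain h where h: "h \<in> iso G H" using assms(3) by (auto simp: is_iso_def)
  have "group_epi G H h" using h assms by (intro group_epiI) (auto simp: iso_iff_mon_epi)
  moreover have "kernel G H h = {\<one>\<^bsub>G\<^esub>}" using h assms by (simp add: iso_kernel_image)
  ultimately show thesis by (rule that)
qed

lemma (in group_epi) comp:
  assumes "group_epi H K k" shows "group_epi G K (k \<circ> h)"
proof -
  interpret k: group_epi H K k by fact
  show ?thesis
    by (rule group_epiI) (use epi_compose[OF epi k.epi] in auto)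
qed

lemma (in group_epi) quotient_iso: "G Mod kernel G H h \<cong> H"
  using iso_of_equal_kernel[OF quotient_epi(1)[OF normal_kernel] group_epi_axioms]
    quotient_epi(2)[OF normal_kernel] by simp

lemma finite_quotient: "finite (carrier G) \<Longrightarrow> finite (carrier (G Mod N))"
  by (simp add: carrier_FactGroup)

text \<open>
  A normal subgroup of the quotient pulls back to a normal subgroup lying above \<open>N\<close>.
\<close>

lemma (in group) maximal_normal_quotient_simple:
  assumes "finite (carrier G)" "N \<lhd> G" "N \<noteq> carrier G"
    and max: "\<And>M. M \<lhd> G \<Longrightarrow> N \<subseteq> M \<Longrightarrow> M = N \<or> M = carrier G"
  shows "simple_group (G Mod N)"
proof -
  interpret q: group_epi G "G Mod N" "\<lambda>x. N #> x" using assms(2) by (rule quotient_epi)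
  have ker: "kernel G (G Mod N) (\<lambda>x. N #> x) = N" using assms(2) by (rule quotient_epi)
  show ?thesis
  proof
    have "order (G Mod N) \<noteq> 1"
    proof
      assume "order (G Mod N) = 1"
      then have "carrier (G Mod N) = {\<one>\<^bsub>G Mod N\<^esub>}" using q.H.order_one_triv_iff by simp
      then have "x \<in> kernel G (G Mod N) (\<lambda>x. N #> x)" if "x \<in> carrier G" for x
        using q.hom_closed[OF that] that unfolding kernel_def by blast
      then show False using ker assms(3) normal_imp_subgroup[OF assms(2)] subgroup.subset by blast
    qed
    moreover have "order (G Mod N) > 0"
      using q.H.order_gt_0_iff_finite finite_quotient[OF assms(1)] by blast
    ultimately show "order (G Mod N) > 1" by simp
  next
    fix H assume H: "H \<lhd> G Mod N"
    let ?V = "{x \<in> carrier G. N #> x \<in> H}"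
    have V: "?V \<lhd> G" using q.normal_vimage[OF H] .
    have sub: "subgroup H (G Mod N)" using H by (rule normal_imp_subgroup)
    have one: "\<one>\<^bsub>G Mod N\<^esub> \<in> H" using sub by (rule subgroup.one_closed)
    have in_N: "x \<in> carrier G \<and> N #> x = N" if "x \<in> N" for x
    proof -
      have "x \<in> kernel G (G Mod N) (\<lambda>x. N #> x)" using that ker by simp
      then show ?thesis by (simp add: kernel_def)
    qed
    have "N \<subseteq> ?V" using in_N one by auto
    then have cases: "?V = N \<or> ?V = carrier G" using max[OF V] by blast
    have img: "(\<lambda>x. N #> x) ` ?V = H" using q.image_vimage subgroup.subset[OF sub] by blast
    show "H = carrier (G Mod N) \<or> H = {\<one>\<^bsub>G Mod N\<^esub>}"
    proof (cases "?V = carrier G")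
      case True then show ?thesis using img q.surj by simp
    next
      case False
      then have "H = (\<lambda>x. N #> x) ` kernel G (G Mod N) (\<lambda>x. N #> x)" using img cases ker by simp
      also have "\<dots> \<subseteq> {\<one>\<^bsub>G Mod N\<^esub>}" unfolding kernel_def by blast
      finally show ?thesis using one by blast
    qed
  qed
qed

section \<open>Subnormal subgroups and composition factors\<close>

inductive subnormal :: "('a, 'b) monoid_scheme \<Rightarrow> 'a set \<Rightarrow> bool" for G where
  top: "subnormal G (carrier G)"
| step: "subnormal G H \<Longrightarrow> B \<lhd> G\<lparr>carrier := H\<rparr> \<Longrightarrow> subnormal G B"

lemma (in group) subnormal_subgroup: "subnormal G B \<Longrightarrow> subgroup B G"
  by (induction rule: subnormal.induct) (auto simp: subgroup_self normal_in_subgroup_iff)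

lemma (in group) normal_subnormal: "N \<lhd> G \<Longrightarrow> subnormal G N"
  using subnormal.step[OF subnormal.top, of N G] by simp

lemma (in group) subnormal_trans:
  assumes "subnormal G H" "subnormal (G\<lparr>carrier := H\<rparr>) B"
  shows "subnormal G B"
  using assms(2)
proof (induction rule: subnormal.induct)
  case top then show ?case using assms(1) by simp
next
  case (step C B) then show ?case using subnormal.step[of G C B] by simp
qed

lemma (in group) normal_inter_subgroup:
  assumes "subgroup H G" "B \<lhd> G\<lparr>carrier := H\<rparr>" "subgroup M G"
  shows "B \<inter> M \<lhd> G\<lparr>carrier := H \<inter> M\<rparr>"
  using assms
  by (auto simp: normal_in_subgroup_iff subgroups_Inter_pair subgroup.m_closed subgroup.m_inv_closed)

lemma (in group) subnormal_inter:
  assumes "subnormal G B" "subgroup M G"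
  shows "subnormal (G\<lparr>carrier := M\<rparr>) (B \<inter> M)"
  using assms(1)
proof (induction rule: subnormal.induct)
  case top
  have "carrier G \<inter> M = M" using assms(2) subgroup.subset by blast
  then show ?case using subnormal.top[of "G\<lparr>carrier := M\<rparr>"] by simp
next
  case (step H B)
  then have "B \<inter> M \<lhd> G\<lparr>carrier := H \<inter> M\<rparr>"
    using normal_inter_subgroup subnormal_subgroup assms(2) by blast
  then show ?case using subnormal.step[OF step.IH, of "B \<inter> M"] by simp
qed

lemma (in group_epi) subnormal_image: "subnormal G B \<Longrightarrow> subnormal H (h ` B)"
proof (induction rule: subnormal.induct)
  case top then show ?case using subnormal.top[of H] by (simp add: surj)
next
  case (step C B)
  then show ?case using subnormal.step normal_in_image G.subnormal_subgroup by blast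
qed

lemma (in group_epi) subnormal_vimage: "subnormal H B \<Longrightarrow> subnormal G {x \<in> carrier G. h x \<in> B}"
proof (induction rule: subnormal.induct)
  case top
  have "{x \<in> carrier G. h x \<in> carrier H} = carrier G" by auto
  then show ?case using subnormal.top[of G] by simp
next
  case (step C B)
  then show ?case using subnormal.step normal_in_vimage H.subnormal_subgroup by blast
qed

lemma (in group) composition_series_append:
  assumes "subgroup C G" "B \<lhd> G\<lparr>carrier := C\<rparr>"
    and "composition_series (G\<lparr>carrier := B\<rparr>) Hs" "simple_group (factor G C B)"
  shows "composition_series (G\<lparr>carrier := C\<rparr>) (Hs @ [C])"
proof -
  have B: "subgroup B G" "B \<subseteq> C" using normal_in_subgroup_iff[OF assms(1)] assms(2) by auto
  have sub: "subgroup H (G\<lparr>carrier := C\<rparr>)" if "subgroup H (G\<lparr>carrier := B\<rparr>)" for H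
    using incl_subgroup[OF B(1) that] subgroup_incl[OF _ assms(1)] subgroup.subset[OF that] B(2) by auto
  have nth: "(Hs @ [C]) ! i = Hs ! i" if "i < length Hs" for i using that by (simp add: nth_append)
  have last: "Hs \<noteq> []" "Hs ! (length Hs - 1) = B" "hd Hs = {\<one>}"
    using assms(3) by (auto simp: composition_series_def last_conv_nth)
  have "(Hs @ [C]) ! i \<lhd> (G\<lparr>carrier := C\<rparr>)\<lparr>carrier := (Hs @ [C]) ! Suc i\<rparr> \<and>
      simple_group (factor (G\<lparr>carrier := C\<rparr>) ((Hs @ [C]) ! Suc i) ((Hs @ [C]) ! i))"
    if "Suc i < length (Hs @ [C])" for i
  proof (cases "Suc i < length Hs")
    case True
    then show ?thesis using assms(3) nth by (auto simp: composition_series_def factor_def)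
  next
    case False
    then have "i = length Hs - 1" "Suc i = length Hs" using that by auto
    then show ?thesis using last assms(2,4) nth by (simp add: factor_def nth_append)
  qed
  moreover have "subgroup C (G\<lparr>carrier := C\<rparr>)"
    using group.subgroup_self[OF subgroup_imp_group[OF assms(1)]] by simp
  ultimately show ?thesis using last assms(3) sub by (auto simp: composition_series_def)
qed

text \<open>
  Between \<open>B\<close> and \<open>C\<close> choose a maximal proper normal subgroup \<open>M\<close> of \<open>C\<close> above \<open>B\<close>. The top quotient
  \<open>C/M\<close> is simple, and the series is first extended from \<open>B\<close> to the smaller group \<open>M\<close>.
\<close>

lemma (in group) composition_series_extend_normal:
  assumes "finite (carrier G)" "subgroup C G" "B \<lhd> G\<lparr>carrier := C\<rparr>"
    and "composition_series (G\<lparr>carrier := B\<rparr>) Hs"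
  shows "\<exists>Ts. composition_series (G\<lparr>carrier := C\<rparr>) (Hs @ Ts)"
  using assms(2,3)
proof (induction "card C" arbitrary: C rule: less_induct)
  case less
  show ?case
  proof (cases "B = C")
    case True
    then show ?thesis using assms(4) by (intro exI[of _ "[]"]) simp
  next
    case False
    interpret C: group "G\<lparr>carrier := C\<rparr>" using less.prems(1) by (rule subgroup_imp_group)
    have finC: "finite C" using assms(1) subgroup.subset[OF less.prems(1)] finite_subset by blast
    define \<M> where "\<M> = {M. M \<lhd> G\<lparr>carrier := C\<rparr> \<and> B \<subseteq> M \<and> M \<noteq> C}"
    have sub: "subgroup M G" "M \<subseteq> C" if "M \<lhd> G\<lparr>carrier := C\<rparr>" for M
      using that normal_in_subgroup_iff[OF less.prems(1)] by auto
    have "\<M> \<subseteq> Pow C" using sub(2) by (auto simp: \<M>_def)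
    then have "finite \<M>" using finC by (meson finite_Pow_iff finite_subset)
    moreover have "B \<in> \<M>" using less.prems(2) False by (simp add: \<M>_def)
    ultimately obtain M where M: "M \<in> \<M>" "\<And>M'. M' \<in> \<M> \<Longrightarrow> M \<subseteq> M' \<Longrightarrow> M = M'"
      using finite_has_maximal2[of \<M> B] by metis
    then have M': "M \<lhd> G\<lparr>carrier := C\<rparr>" "B \<subseteq> M" "M \<noteq> C" by (auto simp: \<M>_def)
    have "card M < card C" using sub(2)[OF M'(1)] M'(3) finC by (intro psubset_card_mono) auto
    moreover have "B \<lhd> G\<lparr>carrier := M\<rparr>"
      using less.prems(2) M'(2) sub[OF M'(1)]
      by (auto simp: normal_in_subgroup_iff less.prems(1))
    ultimately obtain Ts where Ts: "composition_series (G\<lparr>carrier := M\<rparr>) (Hs @ Ts)"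
      using less.hyps sub(1)[OF M'(1)] by blast
    have "simple_group (G\<lparr>carrier := C\<rparr> Mod M)"
    proof (rule C.maximal_normal_quotient_simple[OF _ M'(1)])
      fix M'' assume "M'' \<lhd> G\<lparr>carrier := C\<rparr>" "M \<subseteq> M''"
      then show "M'' = M \<or> M'' = carrier (G\<lparr>carrier := C\<rparr>)"
        using M(2)[of M''] M'(2) by (auto simp: \<M>_def)
    qed (use finC M'(3) in auto)
    then have "composition_series (G\<lparr>carrier := C\<rparr>) ((Hs @ Ts) @ [C])"
      using composition_series_append[OF less.prems(1) M'(1) Ts] by (simp add: factor_def)
    then show ?thesis by auto
  qed
qed

lemma (in group) composition_series_extend:
  assumes "finite (carrier G)" "subnormal G B"
    and "composition_series (G\<lparr>carrier := B\<rparr>) Hs"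
  shows "\<exists>Ts. composition_series G (Hs @ Ts)"
  using assms(2,3)
proof (induction arbitrary: Hs rule: subnormal.induct)
  case top
  then show ?case by (intro exI[of _ "[]"]) simp
next
  case (step C B)
  then obtain Ts where "composition_series (G\<lparr>carrier := C\<rparr>) (Hs @ Ts)"
    using composition_series_extend_normal[OF assms(1)] subnormal_subgroup by blast
  then show ?case using step.IH[of "Hs @ Ts"] by auto
qed

lemma (in group) composition_series_exists:
  assumes "finite (carrier G)" "subgroup K G"
  shows "\<exists>Hs. composition_series (G\<lparr>carrier := K\<rparr>) Hs"
proof -
  have "subgroup {\<one>} (G\<lparr>carrier := {\<one>}\<rparr>)"
    using group.triv_subgroup[OF subgroup_imp_group[OF triv_subgroup]] by simp
  then have "composition_series (G\<lparr>carrier := {\<one>}\<rparr>) [{\<one>}]"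
    by (simp add: composition_series_def)
  moreover have "{\<one>} \<lhd> G\<lparr>carrier := K\<rparr>"
    using group.one_is_normal[OF subgroup_imp_group[OF assms(2)]] by simp
  ultimately show ?thesis using composition_series_extend_normal[OF assms] by blast
qed

lemma (in group) composition_series_subnormal:
  assumes "composition_series G Hs" "i < length Hs"
  shows "subnormal G (Hs ! i)"
proof -
  have "i \<le> length Hs - 1" using assms(2) by simp
  then show ?thesis
  proof (induction rule: inc_induct)
    case base
    have "Hs ! (length Hs - 1) = carrier G"
      using assms(1) by (auto simp: composition_series_def last_conv_nth)
    then show ?case using subnormal.top[of G] by simp
  next
    case (step j)
    then have "Hs ! j \<lhd> G\<lparr>carrier := Hs ! Suc j\<rparr>"
      using assms(1) by (auto simp: composition_series_def)
    then show ?case using subnormal.step step.IH by blast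
  qed
qed

text \<open>
  A term of a composition series is subnormal and maps onto the simple factor at its top. Conversely, a
  subnormal subgroup that maps onto \<open>S\<close>, together with the kernel of that map, can be refined to a
  composition series in which \<open>S\<close> occurs.
\<close>

lemma (in group) Com_iff_subnormal_epi:
  assumes "finite (carrier G)"
  shows "S \<in> Com G \<longleftrightarrow> S \<in> \<JJ> \<and> (\<exists>B f. subnormal G B \<and> group_epi (G\<lparr>carrier := B\<rparr>) S f)"
proof (intro iffI conjI; (elim conjE exE)?)
  assume S: "S \<in> Com G"
  then show "S \<in> \<JJ>" by (simp add: Com_def)
  then have grpS: "group S" by (simp add: simple_groups_def finite_groups_def)
  from S obtain Hs i where Hs: "composition_series G Hs" "Suc i < length Hs"
    and iso: "S \<cong> factor G (Hs ! Suc i) (Hs ! i)" by (auto simp: Com_def)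
  let ?B = "Hs ! Suc i"
  have N: "Hs ! i \<lhd> G\<lparr>carrier := ?B\<rparr>" using Hs by (auto simp: composition_series_def)
  interpret q: group_epi "G\<lparr>carrier := ?B\<rparr>" "factor G ?B (Hs ! i)" "\<lambda>x. Hs ! i #>\<^bsub>G\<lparr>carrier := ?B\<rparr>\<^esub> x"
    using quotient_epi(1)[OF N] by (simp only: factor_def)
  have "factor G ?B (Hs ! i) \<cong> S" using group.iso_sym[OF grpS iso] .
  then obtain h where "group_epi (factor G ?B (Hs ! i)) S h"
    using iso_epi[OF q.H.is_group grpS] by blast
  then have "group_epi (G\<lparr>carrier := ?B\<rparr>) S (h \<circ> (\<lambda>x. Hs ! i #>\<^bsub>G\<lparr>carrier := ?B\<rparr>\<^esub> x))"
    by (rule q.comp)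
  then show "\<exists>B f. subnormal G B \<and> group_epi (G\<lparr>carrier := B\<rparr>) S f"
    using composition_series_subnormal[OF Hs] by blast
next
  fix B f assume S: "S \<in> \<JJ>" and B: "subnormal G B" and "group_epi (G\<lparr>carrier := B\<rparr>) S f"
  then interpret f: group_epi "G\<lparr>carrier := B\<rparr>" S f by simp
  let ?K = "kernel (G\<lparr>carrier := B\<rparr>) S f"
  have subB: "subgroup B G" using B by (rule subnormal_subgroup)
  have K: "?K \<lhd> G\<lparr>carrier := B\<rparr>" by (rule f.normal_kernel)
  then have "subgroup ?K G" using normal_in_subgroup_iff[OF subB] by blast
  then obtain Hs where Hs: "composition_series (G\<lparr>carrier := ?K\<rparr>) Hs"
    using composition_series_exists[OF assms] by blast
  have iso: "factor G B ?K \<cong> S" unfolding factor_def by (rule f.quotient_iso)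
  have grp: "group (factor G B ?K)" unfolding factor_def by (rule normal.factorgroup_is_group[OF K])
  have iso': "S \<cong> factor G B ?K" using group.iso_sym[OF grp iso] .
  then have "simple_group (factor G B ?K)"
    using simple_group.iso_simple[OF _ grp] S unfolding is_iso_def simple_groups_def by blast
  then have "composition_series (G\<lparr>carrier := B\<rparr>) (Hs @ [B])"
    using composition_series_append[OF subB K Hs] by blast
  then obtain Ts where Ts: "composition_series G ((Hs @ [B]) @ Ts)"
    using composition_series_extend[OF assms B] by blast
  have last: "Hs \<noteq> []" "Hs ! (length Hs - 1) = ?K"
    using Hs by (auto simp: composition_series_def last_conv_nth)
  let ?i = "length Hs - 1"
  have "Suc ?i = length Hs" using last(1) by simp
  then have "((Hs @ [B]) @ Ts) ! Suc ?i = B" "((Hs @ [B]) @ Ts) ! ?i = ?K"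
    "Suc ?i < length ((Hs @ [B]) @ Ts)" using last by (auto simp: nth_append)
  then show "S \<in> Com G" unfolding Com_def using Ts iso' S
    by (intro CollectI conjI exI[of _ "(Hs @ [B]) @ Ts"] exI[of _ ?i]) auto
qed

lemma simple_groupsD:
  assumes "S \<in> \<JJ>"
  shows "group S" "finite (carrier S)" "simple_group S" "carrier S \<noteq> {\<one>\<^bsub>S\<^esub>}"
  using assms by (auto simp: simple_groups_def finite_groups_def simple_group.simple_not_triv)

lemma (in group_epi) Com_image_subset:
  assumes "finite (carrier G)" shows "Com H \<subseteq> Com G"
proof
  fix S assume S: "S \<in> Com H"
  have fin: "finite (carrier H)" using assms by (simp flip: surj)
  obtain B f where B: "S \<in> \<JJ>" "subnormal H B" "group_epi (H\<lparr>carrier := B\<rparr>) S f"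
    using S H.Com_iff_subnormal_epi[OF fin] by blast
  let ?V = "{x \<in> carrier G. h x \<in> B}"
  have V: "subnormal G ?V" using B(2) by (rule subnormal_vimage)
  have "subgroup B H" using B(2) by (rule H.subnormal_subgroup)
  then have "h ` ?V = B" using image_vimage subgroup.subset by blast
  then have "group_epi (G\<lparr>carrier := ?V\<rparr>) (H\<lparr>carrier := B\<rparr>) h"
    using restrict_epi[OF G.subnormal_subgroup[OF V]] by simp
  then have "group_epi (G\<lparr>carrier := ?V\<rparr>) S (f \<circ> h)" using B(3) by (rule group_epi.comp)
  then show "S \<in> Com G" using B(1) V G.Com_iff_subnormal_epi[OF assms] by blast
qed

lemma Com_iso:
  assumes "group G" "group H" "finite (carrier G)" "G \<cong> H"
  shows "Com G = Com H"
proof -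
  obtain h where h: "group_epi G H h" using iso_epi[OF assms(1,2,4)] by blast
  obtain k where k: "group_epi H G k" using iso_epi[OF assms(2,1) group.iso_sym[OF assms(1,4)]] by blast
  have "finite (carrier H)" using assms(3) iso_finite[OF assms(4)] by simp
  then have "Com G \<subseteq> Com H" using k by (intro group_epi.Com_image_subset)
  moreover have "Com H \<subseteq> Com G" using h assms(3) by (intro group_epi.Com_image_subset)
  ultimately show ?thesis by (rule equalityI)
qed

lemma (in group) Com_subnormal_subset:
  assumes "finite (carrier G)" "subnormal G B"
  shows "Com (G\<lparr>carrier := B\<rparr>) \<subseteq> Com G"
proof
  fix S assume S: "S \<in> Com (G\<lparr>carrier := B\<rparr>)"
  have B: "subgroup B G" using assms(2) by (rule subnormal_subgroup)
  interpret B: group "G\<lparr>carrier := B\<rparr>" using B by (rule subgroup_imp_group)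
  have "finite (carrier (G\<lparr>carrier := B\<rparr>))" using assms(1) subgroup.subset[OF B] finite_subset by auto
  then obtain D f where "S \<in> \<JJ>" "subnormal (G\<lparr>carrier := B\<rparr>) D" "group_epi (G\<lparr>carrier := D\<rparr>) S f"
    using S B.Com_iff_subnormal_epi by auto
  then show "S \<in> Com G"
    using Com_iff_subnormal_epi[OF assms(1)] subnormal_trans[OF assms(2)] by blast
qed

text \<open>
  Let \<open>M\<close> be the kernel of \<open>h\<close> and let the subnormal subgroup \<open>B\<close> map onto the simple group \<open>S\<close>. The image of
  \<open>B \<inter> M\<close> is normal in \<open>S\<close>. If it is all of \<open>S\<close>, then \<open>S\<close> is a composition factor of \<open>M\<close>; if it is
  trivial, then the map factors through \<open>h ` B\<close>, and \<open>S\<close> is a composition factor of the image of \<open>h\<close>.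
\<close>

lemma (in group_epi) Com_subset_kernel_image:
  assumes "finite (carrier G)"
  shows "Com G \<subseteq> Com (G\<lparr>carrier := kernel G H h\<rparr>) \<union> Com H"
proof
  fix S assume S: "S \<in> Com G"
  let ?M = "kernel G H h"
  obtain B f where B: "S \<in> \<JJ>" "subnormal G B" "group_epi (G\<lparr>carrier := B\<rparr>) S f"
    using S G.Com_iff_subnormal_epi[OF assms] by blast
  interpret f: group_epi "G\<lparr>carrier := B\<rparr>" S f by fact
  have subB: "subgroup B G" using B(2) by (rule G.subnormal_subgroup)
  have subM: "subgroup ?M G" by (rule subgroup_kernel)
  have BM: "B \<inter> ?M \<lhd> G\<lparr>carrier := B\<rparr>"
    using normal_kernel subgroup.subset[OF subB]
    by (auto simp: G.normal_in_subgroup_iff[OF subB] G.normal_inv_iff G.subgroups_Inter_pair subB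
        subgroup.m_closed[OF subB] subgroup.m_inv_closed[OF subB])
  have "f ` (B \<inter> ?M) \<lhd> S" using BM by (rule f.normal_image)
  then consider "f ` (B \<inter> ?M) = carrier S" | "f ` (B \<inter> ?M) = {\<one>\<^bsub>S\<^esub>}"
    using simple_group.no_real_normal_subgroup simple_groupsD(3)[OF B(1)] by blast
  then show "S \<in> Com (G\<lparr>carrier := ?M\<rparr>) \<union> Com H"
  proof cases
    case 1
    interpret M: group "G\<lparr>carrier := ?M\<rparr>" using subM by (rule G.subgroup_imp_group)
    have "subgroup (B \<inter> ?M) (G\<lparr>carrier := B\<rparr>)" using BM by (rule normal_imp_subgroup)
    from f.restrict_epi[OF this] 1 have "group_epi (G\<lparr>carrier := B \<inter> ?M\<rparr>) S f" by simp
    moreover have "subnormal (G\<lparr>carrier := ?M\<rparr>) (B \<inter> ?M)" using B(2) subM by (rule G.subnormal_inter)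
    moreover have "finite (carrier (G\<lparr>carrier := ?M\<rparr>))"
      using assms subgroup.subset[OF subM] finite_subset by auto
    ultimately show ?thesis using M.Com_iff_subnormal_epi B(1) by auto
  next
    case 2
    let ?B' = "h ` B"
    interpret r: group_epi "G\<lparr>carrier := B\<rparr>" "H\<lparr>carrier := ?B'\<rparr>" h using subB by (rule restrict_epi)
    have "kernel (G\<lparr>carrier := B\<rparr>) (H\<lparr>carrier := ?B'\<rparr>) h \<subseteq> kernel (G\<lparr>carrier := B\<rparr>) S f"
      using 2 subgroup.subset[OF subB] by (auto simp: kernel_def)
    from r.factor_hom[OF f.group_hom_axioms this]
    obtain c where c: "c \<in> hom (H\<lparr>carrier := ?B'\<rparr>) S" "\<forall>x\<in>carrier (G\<lparr>carrier := B\<rparr>). c (h x) = f x"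
      by (rule bexE)
    have "c ` (h ` B) = f ` B" unfolding image_image using c(2) by (intro image_cong) auto
    also have "\<dots> = carrier S" using f.surj by simp
    finally have "group_epi (H\<lparr>carrier := ?B'\<rparr>) S c"
      using c(1) by (intro group_epiI r.H.is_group f.H.is_group) (simp add: epi_def)
    moreover have "subnormal H ?B'" using B(2) by (rule subnormal_image)
    moreover have "finite (carrier H)" using assms by (simp flip: surj)
    ultimately show ?thesis using B(1) H.Com_iff_subnormal_epi by blast
  qed
qed

lemma (in group) order_quotient:
  assumes "N \<lhd> G" shows "order (G Mod N) * card N = order G"
  using lagrange[OF normal_imp_subgroup[OF assms]] by (simp add: order_def FactGroup_def)

lemma (in group) Com_order_dvd:
  assumes "finite (carrier G)" "S \<in> Com G"
  shows "order S dvd order G"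
proof -
  obtain B f where B: "subnormal G B" "group_epi (G\<lparr>carrier := B\<rparr>) S f"
    using assms Com_iff_subnormal_epi by blast
  interpret f: group_epi "G\<lparr>carrier := B\<rparr>" S f by fact
  have sub: "subgroup B G" using B(1) by (rule subnormal_subgroup)
  have "order S = order (G\<lparr>carrier := B\<rparr> Mod kernel (G\<lparr>carrier := B\<rparr>) S f)"
    using f.quotient_iso unfolding order_def by (metis iso_same_card)
  also have "\<dots> * card (kernel (G\<lparr>carrier := B\<rparr>) S f) = order (G\<lparr>carrier := B\<rparr>)"
    using f.G.order_quotient[OF f.normal_kernel] .
  finally have "order S dvd order (G\<lparr>carrier := B\<rparr>)" by (metis dvd_triv_left)
  also have "order (G\<lparr>carrier := B\<rparr>) dvd order G"
    using dvd_triv_right[of "card B" "card (rcosets B)"] lagrange[OF sub] by (simp add: order_def)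
  finally show ?thesis .
qed

lemma (in group) exists_maximal_normal:
  assumes "finite (carrier G)" "carrier G \<noteq> {\<one>}"
  obtains M where "M \<lhd> G" "M \<noteq> carrier G" "simple_group (G Mod M)"
proof -
  define \<M> where "\<M> = {M. M \<lhd> G \<and> M \<noteq> carrier G}"
  have "\<M> \<subseteq> Pow (carrier G)" using normal_imp_subgroup subgroup.subset unfolding \<M>_def by blast
  then have "finite \<M>" using assms(1) by (meson finite_Pow_iff finite_subset)
  moreover have "{\<one>} \<in> \<M>" using one_is_normal assms(2) by (auto simp: \<M>_def)
  ultimately obtain M where M: "M \<in> \<M>" "\<And>M'. M' \<in> \<M> \<Longrightarrow> M \<subseteq> M' \<Longrightarrow> M = M'"
    using finite_has_maximal2[of \<M> "{\<one>}"] by metis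
  have "simple_group (G Mod M)"
    by (rule maximal_normal_quotient_simple) (use M assms(1) in \<open>auto simp: \<M>_def\<close>)
  with M(1) show thesis by (intro that[of M]) (auto simp: \<M>_def)
qed

lemma (in group) simple_quotient_in_Com:
  assumes "finite (carrier G)" "M \<lhd> G" "simple_group (G Mod M)"
  shows "nat_copy (G Mod M) \<in> Com G" "G Mod M \<cong> nat_copy (G Mod M)"
proof -
  interpret q: group_epi G "G Mod M" "\<lambda>x. M #> x" using assms(2) by (rule quotient_epi)
  have fin: "finite (carrier (G Mod M))" using assms(1) by (rule finite_quotient)
  note copy = nat_copy[OF q.H.is_group fin]
  show iso: "G Mod M \<cong> nat_copy (G Mod M)" by (rule copy)
  then obtain h where h: "group_epi (G Mod M) (nat_copy (G Mod M)) h"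
    using iso_epi[OF q.H.is_group copy(1)] by blast
  have "simple_group (nat_copy (G Mod M))"
    using simple_group.iso_simple[OF assms(3) copy(1)] copy(2) unfolding is_iso_def by blast
  then have "nat_copy (G Mod M) \<in> \<JJ>"
    using copy(1) fin iso_finite[OF iso] by (simp add: simple_groups_def finite_groups_def)
  moreover have "group_epi (G\<lparr>carrier := carrier G\<rparr>) (nat_copy (G Mod M)) (h \<circ> (\<lambda>x. M #> x))"
    using q.comp[OF h] by simp
  ultimately show "nat_copy (G Mod M) \<in> Com G"
    using Com_iff_subnormal_epi[OF assms(1)] subnormal.top by blast
qed

lemma (in group) Com_nonempty:
  assumes "finite (carrier G)" "carrier G \<noteq> {\<one>}" shows "Com G \<noteq> {}"
  using exists_maximal_normal[OF assms] simple_quotient_in_Com(1)[OF assms(1)] by blast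

lemma (in group) Com_trivial:
  assumes "carrier G = {\<one>}" shows "Com G = {}"
proof -
  have False if "S \<in> Com G" for S
  proof -
    have "order S dvd 1" using Com_order_dvd[OF _ that] assms by (simp add: order_def)
    moreover have "S \<in> \<JJ>" using that by (simp add: Com_def)
    ultimately show False using simple_groupsD(3) simple_group.order_gt_one by fastforce
  qed
  then show ?thesis by blast
qed

text \<open>
  The order of a group is the order of a simple quotient times the order of the corresponding normal subgroup.
\<close>

lemma (in group) Com_prime_divisor:
  assumes "finite (carrier G)" "prime p" "p dvd order G"
  shows "\<exists>S\<in>Com G. p dvd order S"
proof -
  have "\<exists>S\<in>Com (G\<lparr>carrier := C\<rparr>). p dvd order S" if "subgroup C G" "p dvd card C" for C
    using that
  proof (induction "card C" arbitrary: C rule: less_induct)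
    case less
    interpret C: group "G\<lparr>carrier := C\<rparr>" using less.prems(1) by (rule subgroup_imp_group)
    have finC: "finite (carrier (G\<lparr>carrier := C\<rparr>))"
      using assms(1) subgroup.subset[OF less.prems(1)] finite_subset by auto
    have "C \<noteq> {\<one>}" using less.prems(2) assms(2) by auto
    then obtain M where M: "M \<lhd> G\<lparr>carrier := C\<rparr>" "M \<noteq> C" "simple_group (G\<lparr>carrier := C\<rparr> Mod M)"
      using C.exists_maximal_normal[OF finC] by auto
    have subM: "subgroup M G" "M \<subseteq> C" using M(1) normal_in_subgroup_iff[OF less.prems(1)] by auto
    have "order (G\<lparr>carrier := C\<rparr> Mod M) * card M = card C"
      using C.order_quotient[OF M(1)] by (simp add: order_def)
    then consider "p dvd order (G\<lparr>carrier := C\<rparr> Mod M)" | "p dvd card M"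
      using less.prems(2) assms(2) prime_dvd_mult_iff by metis
    then show ?case
    proof cases
      case 1
      note c = C.simple_quotient_in_Com[OF finC M(1,3)]
      show ?thesis using 1 c(1) iso_same_card[OF c(2)] unfolding order_def by auto
    next
      case 2
      have "card M < card C" using M(2) subM(2) finC by (intro psubset_card_mono) auto
      then obtain S where "S \<in> Com (G\<lparr>carrier := M\<rparr>)" "p dvd order S"
        using less.hyps subM(1) 2 by blast
      then show ?thesis
        using C.Com_subnormal_subset[OF finC C.normal_subnormal[OF M(1)]] by auto
    qed
  qed
  from this[OF subgroup_self] assms(3) show ?thesis by (simp add: order_def)
qed

lemma Com_comm_group:
  assumes "comm_group G" "finite (carrier G)" "S \<in> Com G"
  shows "comm_group S"
proof -
  interpret comm_group G by fact
  obtain B f where B: "subnormal G B" "group_epi (G\<lparr>carrier := B\<rparr>) S f"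
    using assms Com_iff_subnormal_epi by blast
  interpret f: group_epi "G\<lparr>carrier := B\<rparr>" S f by fact
  have sub: "B \<subseteq> carrier G" using subnormal_subgroup[OF B(1)] by (rule subgroup.subset)
  show ?thesis
  proof (rule f.H.group_comm_groupI)
    fix x y assume "x \<in> carrier S" "y \<in> carrier S"
    then obtain a b where ab: "a \<in> B" "x = f a" "b \<in> B" "y = f b" by (auto simp flip: f.surj)
    then have "f (a \<otimes>\<^bsub>G\<^esub> b) = f (b \<otimes>\<^bsub>G\<^esub> a)" using sub ab m_comm[of a b] by (simp add: subset_iff)
    then show "x \<otimes>\<^bsub>S\<^esub> y = y \<otimes>\<^bsub>S\<^esub> x" using ab f.hom_mult by auto
  qed
qed

lemma Com_simple:
  assumes "P \<in> \<JJ>" shows "Com P = {S \<in> \<JJ>. S \<cong> P}"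
proof -
  interpret simple_group P using assms by (rule simple_groupsD)
  have fin: "finite (carrier P)" using assms by (rule simple_groupsD)
  have sub: "B = carrier P \<or> B = {\<one>\<^bsub>P\<^esub>}" if "subnormal P B" for B
    using that
  proof (induction rule: subnormal.induct)
    case (step H B)
    have one: "\<one>\<^bsub>P\<^esub> \<in> B"
      by (rule subgroup.one_closed[OF subnormal_subgroup[OF subnormal.step[OF step.hyps]]])
    from step.IH show ?case
    proof
      assume "H = carrier P"
      then show ?thesis using step.hyps(2) no_real_normal_subgroup by simp
    next
      assume "H = {\<one>\<^bsub>P\<^esub>}"
      then show ?thesis using one step.hyps(2) normal_in_subgroup_iff[OF triv_subgroup] by auto
    qed
  qed simp
  show ?thesis
  proof (intro equalityI subsetI CollectI)
    fix S assume S: "S \<in> Com P"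
    obtain B f where B: "S \<in> \<JJ>" "subnormal P B" "group_epi (P\<lparr>carrier := B\<rparr>) S f"
      using S fin Com_iff_subnormal_epi by blast
    interpret S: simple_group S using B(1) by (rule simple_groupsD)
    note S' = simple_groupsD[OF B(1)]
    have "B \<noteq> {\<one>\<^bsub>P\<^esub>}"
    proof
      assume "B = {\<one>\<^bsub>P\<^esub>}"
      then have "carrier S = {f \<one>\<^bsub>P\<^esub>}" using group_epi.surj[OF B(3)] by auto
      moreover have "\<one>\<^bsub>S\<^esub> \<in> carrier S" by (rule S.one_closed)
      ultimately show False using S'(4) by auto
    qed
    then have BP: "B = carrier P" using sub B(2) by blast
    have "P\<lparr>carrier := B\<rparr> = P" unfolding BP by simp
    with B(3) have "group_epi P S f" by (simp only:)
    then interpret g: group_epi P S f .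
    have "kernel P S f \<noteq> carrier P"
    proof
      assume *: "kernel P S f = carrier P"
      have "x = \<one>\<^bsub>S\<^esub>" if x: "x \<in> carrier S" for x
      proof -
        obtain a where a: "a \<in> carrier P" "x = f a" using x by (auto simp flip: g.surj)
        then have "a \<in> kernel P S f" using * by simp
        then show ?thesis using a by (simp add: kernel_def)
      qed
      then have "carrier S = {\<one>\<^bsub>S\<^esub>}" using S.one_closed by blast
      then show False using S'(4) by simp
    qed
    then have "kernel P S f = {\<one>\<^bsub>P\<^esub>}" using no_real_normal_subgroup g.normal_kernel by blast
    then have "f \<in> iso P S" using g.epi by (simp add: iso_kernel_image[OF is_group S.is_group] epi_def)
    then have "P \<cong> S" by (rule is_isoI)
    then show "S \<in> \<JJ> \<and> S \<cong> P" using B(1) iso_sym by blast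
  next
    fix S assume "S \<in> {S \<in> \<JJ>. S \<cong> P}"
    then have S: "S \<in> \<JJ>" "S \<cong> P" by auto
    obtain h where "group_epi P S h"
      using iso_epi[OF is_group simple_groupsD(1)[OF S(1)]] group.iso_sym[OF simple_groupsD(1)[OF S(1)] S(2)] by blast
    then have "group_epi (P\<lparr>carrier := carrier P\<rparr>) S h" by simp
    then show "S \<in> Com P" using S(1) Com_iff_subnormal_epi[OF fin] subnormal.top by blast
  qed
qed

section \<open>Composition factors of chief factors\<close>

lemma (in group) mem_set_mult_normal:
  assumes "M1 \<lhd> G" "M2 \<lhd> G"
  shows "M1 \<subseteq> M1 <#> M2" "M2 \<subseteq> M1 <#> M2"
proof -
  have s: "subgroup M1 G" "subgroup M2 G" using assms normal_imp_subgroup by auto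
  show "M1 \<subseteq> M1 <#> M2"
    using subgroup.one_closed[OF s(2)] subgroup.subset[OF s(1)] r_one unfolding set_mult_def by force
  show "M2 \<subseteq> M1 <#> M2"
    using subgroup.one_closed[OF s(1)] subgroup.subset[OF s(2)] l_one unfolding set_mult_def by force
qed

text \<open>
  The quotient of \<open>M1 <#> M2\<close> by \<open>M1\<close> is an image of \<open>M2\<close>.
\<close>

lemma (in group) Com_set_mult:
  assumes "finite (carrier G)" "M1 \<lhd> G" "M2 \<lhd> G"
  shows "Com (G\<lparr>carrier := M1 <#> M2\<rparr>) \<subseteq> Com (G\<lparr>carrier := M1\<rparr>) \<union> Com (G\<lparr>carrier := M2\<rparr>)"
proof -
  let ?K = "M1 <#> M2"
  note sub = mem_set_mult_normal[OF assms(2,3)]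
  have K: "?K \<lhd> G" using assms(2,3) by (rule normal_subgroup_set_mult_closed)
  have sK: "subgroup ?K G" "subgroup M2 G" "subgroup M1 G" using K assms normal_imp_subgroup by auto
  have M1: "M1 \<lhd> G\<lparr>carrier := ?K\<rparr>"
    using assms(2) sub(1) subgroup.subset[OF sK(1)] by (auto simp: normal_in_subgroup_iff[OF sK(1)] normal_inv_iff)
  let ?Q = "G\<lparr>carrier := ?K\<rparr> Mod M1" and ?q = "\<lambda>x. M1 #>\<^bsub>G\<lparr>carrier := ?K\<rparr>\<^esub> x"
  interpret q: group_epi "G\<lparr>carrier := ?K\<rparr>" ?Q ?q using M1 by (rule quotient_epi)
  have fin: "finite (carrier (G\<lparr>carrier := ?K\<rparr>))"
    using assms(1) subgroup.subset[OF sK(1)] finite_subset by auto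
  have fin2: "finite (carrier (G\<lparr>carrier := M2\<rparr>))"
    using assms(1) subgroup.subset[OF sK(2)] finite_subset by auto
  have "?q ` M2 = carrier ?Q"
  proof (intro equalityI subsetI)
    fix y assume "y \<in> ?q ` M2" then show "y \<in> carrier ?Q" using sub(2) by (auto simp: carrier_FactGroup)
  next
    fix y assume "y \<in> carrier ?Q"
    then obtain a b where ab: "a \<in> M1" "b \<in> M2" "y = M1 #> (a \<otimes> b)"
      by (auto simp: carrier_FactGroup set_mult_def)
    have c: "a \<in> carrier G" "b \<in> carrier G" "M1 \<subseteq> carrier G" using ab sK subgroup.subset by auto
    have "y = M1 #> b"
      unfolding ab(3) using coset_mult_assoc[OF c(3,1,2)] coset_join2[OF c(1) sK(3) ab(1)] by simp
    then show "y \<in> ?q ` M2" using ab(2) by simp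
  qed
  then have "group_epi (G\<lparr>carrier := M2\<rparr>) ?Q ?q"
    using q.restrict_epi[OF subgroup_incl[OF sK(2,1) sub(2)]] by simp
  then have "Com ?Q \<subseteq> Com (G\<lparr>carrier := M2\<rparr>)" using fin2 by (rule group_epi.Com_image_subset)
  moreover have "Com (G\<lparr>carrier := ?K\<rparr>) \<subseteq> Com (G\<lparr>carrier := M1\<rparr>) \<union> Com ?Q"
    using q.Com_subset_kernel_image[OF fin] quotient_epi(2)[OF M1] by simp
  ultimately show ?thesis by blast
qed

lemma (in group) conjugation_epi:
  assumes "g \<in> carrier G" shows "group_epi G G (\<lambda>x. g \<otimes> x \<otimes> inv g)"
proof (intro group_epiI is_group)
  have "g \<otimes> (x \<otimes> y) \<otimes> inv g = g \<otimes> x \<otimes> inv g \<otimes> (g \<otimes> y \<otimes> inv g)"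
    if "x \<in> carrier G" "y \<in> carrier G" for x y
    using that assms by (simp add: m_assoc inv_solve_left)
  moreover have "g \<otimes> (inv g \<otimes> y \<otimes> g) \<otimes> inv g = y" if "y \<in> carrier G" for y
  proof -
    have "g \<otimes> (inv g \<otimes> y) = y" using that assms by (simp flip: m_assoc)
    then show ?thesis using that assms by (simp add: m_assoc)
  qed
  then have "y \<in> (\<lambda>x. g \<otimes> x \<otimes> inv g) ` carrier G" if "y \<in> carrier G" for y
    using that assms by (intro image_eqI[of _ _ "inv g \<otimes> y \<otimes> g"]) auto
  ultimately show "(\<lambda>x. g \<otimes> x \<otimes> inv g) \<in> epi G G"
    using assms unfolding epi_iff_subset by (auto simp: hom_def)
qed

lemma (in group) exists_minimal_normal:
  assumes "finite (carrier G)" "N \<lhd> G" "N \<noteq> {\<one>}"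
  obtains T where "minimal_normal T G" "T \<subseteq> N"
proof -
  define \<M> where "\<M> = {M. M \<lhd> G \<and> M \<noteq> {\<one>}}"
  have "\<M> \<subseteq> Pow (carrier G)" using normal_imp_subgroup subgroup.subset unfolding \<M>_def by blast
  then have "finite \<M>" using assms(1) by (meson finite_Pow_iff finite_subset)
  moreover have "N \<in> \<M>" using assms by (auto simp: \<M>_def)
  ultimately obtain T where T: "T \<in> \<M>" "T \<subseteq> N" "\<And>M'. M' \<in> \<M> \<Longrightarrow> M' \<subseteq> T \<Longrightarrow> T = M'"
    using finite_has_minimal2[of \<M> N] by metis
  then have "minimal_normal T G" unfolding minimal_normal_def \<M>_def by blast
  then show thesis using T(2) by (rule that)
qed

text \<open>
  Induction on the order of \<open>N\<close>. A minimal normal subgroup \<open>P\<close> of \<open>N\<close> has, by induction, a single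
  composition factor up to isomorphism, unless \<open>P = N\<close>, in which case \<open>N\<close> is simple. Normal subgroups
  of \<open>N\<close> whose composition factors occur in \<open>P\<close> are closed under products, so there is a largest one.
  It is invariant under conjugation by \<open>G\<close>, hence equal to \<open>N\<close>. This avoids the decomposition of \<open>N\<close> as
  a direct product of simple groups.
\<close>

lemma Com_minimal_normal_iso:
  assumes "group G" "finite (carrier G)" "minimal_normal N G"
    and "S \<in> Com (G\<lparr>carrier := N\<rparr>)" "T \<in> Com (G\<lparr>carrier := N\<rparr>)"
  shows "S \<cong> T"
  using assms
proof (induction "card N" arbitrary: N G S T rule: less_induct)
  case less
  interpret group G by fact
  have N: "N \<lhd> G" "N \<noteq> {\<one>\<^bsub>G\<^esub>}" using less.prems(3) by (auto simp: minimal_normal_def)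
  have sN: "subgroup N G" using N(1) by (rule normal_imp_subgroup)
  let ?N = "G\<lparr>carrier := N\<rparr>"
  interpret N: group ?N using sN by (rule subgroup_imp_group)
  have finN: "finite (carrier ?N)" using less.prems(2) subgroup.subset[OF sN] finite_subset by auto
  have "N \<lhd> ?N" using normal_in_subgroup_iff[OF sN] sN
    by (auto simp: subgroup.m_closed subgroup.m_inv_closed)
  then obtain P where P: "minimal_normal P ?N" "P \<subseteq> N"
    using N.exists_minimal_normal[OF finN] N(2) by auto
  have Pn: "P \<lhd> ?N" "P \<noteq> {\<one>\<^bsub>G\<^esub>}" using P(1) by (auto simp: minimal_normal_def)
  show ?case
  proof (cases "P = N")
    case True
    have "simple_group ?N"
    proof
      have "order ?N \<noteq> 1" using N.order_one_triv_iff N(2) by simp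
      moreover have "order ?N > 0" using N.order_gt_0_iff_finite finN by blast
      ultimately show "1 < order ?N" by simp
    next
      fix H assume "H \<lhd> ?N"
      then show "H = carrier ?N \<or> H = {\<one>\<^bsub>?N\<^esub>}"
        using P(1) True normal_imp_subgroup[THEN subgroup.subset] unfolding minimal_normal_def by fastforce
    qed
    note simple = this
    let ?S = "nat_copy ?N"
    note copy = nat_copy[OF N.is_group finN]
    have "?S \<in> \<JJ>"
      using simple_group.iso_simple[OF simple copy(1)] copy finN iso_finite[OF copy(2)]
      by (auto simp: simple_groups_def finite_groups_def is_iso_def)
    moreover have "Com ?N = Com ?S" using Com_iso[OF N.is_group copy(1) finN copy(2)] .
    ultimately have "S \<in> \<JJ>" "T \<in> \<JJ>" "S \<cong> ?S" "T \<cong> ?S"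
      using less.prems(4,5) Com_simple[of ?S] by auto
    then show ?thesis using iso_trans group.iso_sym[OF simple_groupsD(1)[OF \<open>T \<in> \<JJ>\<close>]] by blast
  next
    case False
    have "card P < card N" using False P(2) finN by (intro psubset_card_mono) auto
    then have single: "S \<cong> T" if "S \<in> Com (G\<lparr>carrier := P\<rparr>)" "T \<in> Com (G\<lparr>carrier := P\<rparr>)" for S T
      using less.hyps[of P ?N S T] P(1) finN that N.is_group by simp
    \<comment> \<open>By closure under products, a maximal member of this family is its greatest member.\<close>
    define \<W> where "\<W> = {M. M \<lhd> ?N \<and> Com (G\<lparr>carrier := M\<rparr>) \<subseteq> Com (G\<lparr>carrier := P\<rparr>)}"
    have "\<W> \<subseteq> Pow N" using normal_imp_subgroup[THEN subgroup.subset] unfolding \<W>_def by fastforce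
    then have "finite \<W>" using finN by (simp add: finite_subset)
    moreover have "P \<in> \<W>" using Pn(1) by (simp add: \<W>_def)
    ultimately obtain R where R: "R \<in> \<W>" "P \<subseteq> R" "\<And>M. M \<in> \<W> \<Longrightarrow> R \<subseteq> M \<Longrightarrow> R = M"
      using finite_has_maximal2[of \<W> P] by metis
    have Rn: "R \<lhd> ?N" and RC: "Com (G\<lparr>carrier := R\<rparr>) \<subseteq> Com (G\<lparr>carrier := P\<rparr>)"
      using R(1) by (auto simp: \<W>_def)
    have sR: "subgroup R G" "R \<subseteq> N" using Rn normal_in_subgroup_iff[OF sN] by auto
    have greatest: "M \<subseteq> R" if M: "M \<in> \<W>" for M
    proof -
      have Mn: "M \<lhd> ?N" using M by (simp add: \<W>_def)
      have "R <#>\<^bsub>?N\<^esub> M \<in> \<W>"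
        using N.normal_subgroup_set_mult_closed[OF Rn Mn] N.Com_set_mult[OF finN Rn Mn] RC M
        by (auto simp: \<W>_def)
      moreover have "R \<subseteq> R <#>\<^bsub>?N\<^esub> M" "M \<subseteq> R <#>\<^bsub>?N\<^esub> M"
        using N.mem_set_mult_normal[OF Rn Mn] by auto
      ultimately show ?thesis using R(3) by blast
    qed
    \<comment> \<open>Conjugation by an element of \<open>G\<close> permutes the family, hence fixes its greatest member.\<close>
    have "g \<otimes>\<^bsub>G\<^esub> x \<otimes>\<^bsub>G\<^esub> inv\<^bsub>G\<^esub> g \<in> R" if g: "g \<in> carrier G" and x: "x \<in> R" for g x
    proof -
      let ?c = "\<lambda>x. g \<otimes>\<^bsub>G\<^esub> x \<otimes>\<^bsub>G\<^esub> inv\<^bsub>G\<^esub> g"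
      interpret c: group_epi G G ?c using g by (rule conjugation_epi)
      have "?c ` N \<subseteq> N" using N(1) g by (auto simp: normal_inv_iff)
      moreover have "card (?c ` N) = card N"
      proof (rule card_image, rule inj_onI)
        fix x y assume "x \<in> N" "y \<in> N" and eq: "?c x = ?c y"
        moreover from this have "x \<in> carrier G" "y \<in> carrier G" using subgroup.subset[OF sN] by auto
        ultimately show "x = y" using g by simp
      qed
      ultimately have cN: "?c ` N = N" using finN by (simp add: card_subset_eq)
      have "?c ` R \<lhd> ?N" using c.normal_in_image[OF sN Rn] cN by simp
      moreover have "Com (G\<lparr>carrier := ?c ` R\<rparr>) \<subseteq> Com (G\<lparr>carrier := R\<rparr>)"
        using group_epi.Com_image_subset[OF c.restrict_epi[OF sR(1)]] finN sR(2) finite_subset by auto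
      ultimately have "?c ` R \<in> \<W>" using RC by (auto simp: \<W>_def)
      then show ?thesis using greatest x by blast
    qed
    then have "R \<lhd> G" using sR(1) by (simp add: normal_inv_iff)
    moreover have "R \<noteq> {\<one>\<^bsub>G\<^esub>}"
      using R(2) Pn(2) subgroup.one_closed[OF normal_imp_subgroup[OF Pn(1)]] by auto
    ultimately have "R = N" using less.prems(3) sR(2) unfolding minimal_normal_def by blast
    then show ?thesis using single RC less.prems(4,5) by blast
  qed
qed

lemma (in group) minimal_normal_iff_chief_factor:
  "minimal_normal N G \<longleftrightarrow> chief_factor G N {\<one>}"
proof
  assume "minimal_normal N G"
  then show "chief_factor G N {\<one>}"
    using one_is_normal normal_imp_subgroup[THEN subgroup.one_closed]
    unfolding minimal_normal_def chief_factor_def by blast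
next
  assume "chief_factor G N {\<one>}"
  then show "minimal_normal N G"
    using normal_imp_subgroup[THEN subgroup.one_closed]
    unfolding minimal_normal_def chief_factor_def by blast
qed

lemma (in group_epi) chief_factor_image:
  assumes "chief_factor G A K" "kernel G H h \<subseteq> K"
  shows "chief_factor H (h ` A) (h ` K)"
proof -
  have A: "A \<lhd> G" "K \<lhd> G" "K \<subset> A" "\<And>N. N \<lhd> G \<Longrightarrow> K \<subseteq> N \<Longrightarrow> N \<subseteq> A \<Longrightarrow> N = K \<or> N = A"
    using assms(1) by (auto simp: chief_factor_def)
  have s: "subgroup A G" "subgroup K G" using A normal_imp_subgroup by auto
  have kA: "kernel G H h \<subseteq> A" using A(3) assms(2) by blast
  have ne: "h ` K \<noteq> h ` A"
    using vimage_image[OF s(2) assms(2)] vimage_image[OF s(1) kA] A(3) by (metis psubset_eq)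
  have mx: "N = h ` K \<or> N = h ` A" if N: "N \<lhd> H" "h ` K \<subseteq> N" "N \<subseteq> h ` A" for N
  proof -
    let ?V = "{x \<in> carrier G. h x \<in> N}"
    have "K \<subseteq> ?V" using N(2) subgroup.subset[OF s(2)] by auto
    moreover have "?V \<subseteq> A" using N(3) vimage_image[OF s(1) kA] by blast
    ultimately have "?V = K \<or> ?V = A" using A(4)[OF normal_vimage[OF N(1)]] by blast
    moreover have "h ` ?V = N"
      by (rule image_vimage[OF subgroup.subset[OF normal_imp_subgroup[OF N(1)]]])
    ultimately show ?thesis by metis
  qed
  have "h ` K \<subset> h ` A" using ne A(3) by (simp add: psubset_eq image_mono)
  then show ?thesis
    unfolding chief_factor_def using mx by (intro conjI normal_image A allI impI) simp_all
qed

lemma (in group_epi) chief_factor_vimage: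
  assumes "chief_factor H A K"
  shows "chief_factor G {x \<in> carrier G. h x \<in> A} {x \<in> carrier G. h x \<in> K}"
proof -
  have A: "A \<lhd> H" "K \<lhd> H" "K \<subset> A" "\<And>N. N \<lhd> H \<Longrightarrow> K \<subseteq> N \<Longrightarrow> N \<subseteq> A \<Longrightarrow> N = K \<or> N = A"
    using assms(1) by (auto simp: chief_factor_def)
  have s: "A \<subseteq> carrier H" "K \<subseteq> carrier H" 
    using A(1,2) by (auto dest!: normal_imp_subgroup[THEN subgroup.subset])
  let ?A = "{x \<in> carrier G. h x \<in> A}" and ?K = "{x \<in> carrier G. h x \<in> K}"
  have ne: "?K \<noteq> ?A" using image_vimage[OF s(1)] image_vimage[OF s(2)] A(3) by (metis psubset_eq)
  have mx: "N = ?K \<or> N = ?A" if N: "N \<lhd> G" "?K \<subseteq> N" "N \<subseteq> ?A" for N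
  proof -
    have sN: "subgroup N G" using N(1) by (rule normal_imp_subgroup)
    have "kernel G H h \<subseteq> ?K"
      using subgroup.one_closed[OF normal_imp_subgroup[OF A(2)]] by (auto simp: kernel_def)
    then have "kernel G H h \<subseteq> N" using N(2) by blast
    from vimage_image[OF sN this] have V: "{x \<in> carrier G. h x \<in> h ` N} = N" .
    have "K \<subseteq> h ` N" using image_vimage[OF s(2)] N(2) by blast
    moreover have "h ` N \<subseteq> A" using N(3) by blast
    ultimately have "h ` N = K \<or> h ` N = A" using A(4)[OF normal_image[OF N(1)]] by blast
    then show ?thesis using V by metis
  qed
  have "?K \<subset> ?A" using ne A(3) by (intro psubsetI) auto
  then show ?thesis
    unfolding chief_factor_def using mx by (intro conjI normal_vimage A allI impI) simp_all
qed

lemma (in group_epi) quotient_image_iso: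
  assumes "N \<lhd> G" "kernel G H h \<subseteq> N"
  shows "G Mod N \<cong> H Mod (h ` N)"
proof -
  have N': "h ` N \<lhd> H" using assms(1) by (rule normal_image)
  let ?q = "\<lambda>x. h ` N #>\<^bsub>H\<^esub> x"
  have q: "group_epi H (H Mod (h ` N)) ?q" and k: "kernel H (H Mod (h ` N)) ?q = h ` N"
    using quotient_epi[OF N'] by auto
  have "kernel G (H Mod (h ` N)) (?q \<circ> h) = {x \<in> carrier G. h x \<in> kernel H (H Mod (h ` N)) ?q}"
    by (auto simp: kernel_def)
  also have "\<dots> = N" unfolding k by (rule vimage_image[OF normal_imp_subgroup[OF assms(1)] assms(2)])
  finally show ?thesis
    using iso_of_equal_kernel[OF quotient_epi(1)[OF assms(1)] comp[OF q]] quotient_epi(2)[OF assms(1)] by simp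
qed

lemma (in group_epi) factor_image_iso:
  assumes "subgroup A G" "K \<lhd> G\<lparr>carrier := A\<rparr>" "kernel G H h \<subseteq> K"
  shows "factor G A K \<cong> factor H (h ` A) (h ` K)"
proof -
  interpret r: group_epi "G\<lparr>carrier := A\<rparr>" "H\<lparr>carrier := h ` A\<rparr>" h using assms(1) by (rule restrict_epi)
  have "kernel (G\<lparr>carrier := A\<rparr>) (H\<lparr>carrier := h ` A\<rparr>) h \<subseteq> K"
    using assms(3) subgroup.subset[OF assms(1)] by (auto simp: kernel_def)
  then show ?thesis unfolding factor_def by (rule r.quotient_image_iso[OF assms(2)])
qed

section \<open>Centralizers and small centralizers under epimorphisms\<close>

lemma (in group_epi) image_eq_iff:
  assumes "x \<in> carrier G" "y \<in> carrier G"
  shows "h x = h y \<longleftrightarrow> x \<otimes> inv y \<in> kernel G H h"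
proof -
  have "x \<otimes> inv y \<in> kernel G H h \<longleftrightarrow> h x \<otimes>\<^bsub>H\<^esub> inv\<^bsub>H\<^esub> h y = \<one>\<^bsub>H\<^esub>"
    using assms by (simp add: kernel_def)
  also have "\<dots> \<longleftrightarrow> h x = h y"
    using H.inv_solve_right'[of "\<one>\<^bsub>H\<^esub>" "h x" "h y"] assms by simp
  finally show ?thesis by simp
qed

text \<open>
  In terms of the quotient map, centralizing a factor is commuting with its image; this makes
  normality and compatibility with further epimorphisms evident.
\<close>

lemma (in group_epi) mem_centralizer_iff:
  assumes "A \<subseteq> carrier G"
  shows "g \<in> centralizer G A (kernel G H h) \<longleftrightarrow>
    g \<in> carrier G \<and> (\<forall>a\<in>A. h g \<otimes>\<^bsub>H\<^esub> h a = h a \<otimes>\<^bsub>H\<^esub> h g)"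
proof -
  let ?K = "kernel G H h"
  interpret q: group_epi G "G Mod ?K" "\<lambda>x. ?K #> x" using normal_kernel by (rule quotient_epi)
  have "?K #> (g \<otimes> a \<otimes> inv g) = ?K #> a \<longleftrightarrow> h g \<otimes>\<^bsub>H\<^esub> h a = h a \<otimes>\<^bsub>H\<^esub> h g"
    if g: "g \<in> carrier G" and "a \<in> A" for a
  proof -
    have a: "a \<in> carrier G" using that assms by blast
    have u: "g \<otimes> a \<otimes> inv g \<in> carrier G" using g a by simp
    have "?K #> (g \<otimes> a \<otimes> inv g) = ?K #> a \<longleftrightarrow> h (g \<otimes> a \<otimes> inv g) = h a"
      unfolding q.image_eq_iff[OF u a] image_eq_iff[OF u a] quotient_epi(2)[OF normal_kernel] by (rule refl)
    also have "\<dots> \<longleftrightarrow> h g \<otimes>\<^bsub>H\<^esub> h a = h a \<otimes>\<^bsub>H\<^esub> h g"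
      using H.inv_solve_right'[of "h a" "h g \<otimes>\<^bsub>H\<^esub> h a" "h g"] g a by auto
    finally show ?thesis .
  qed
  then show ?thesis unfolding centralizer_def by auto
qed

lemma (in group) commutant_normal:
  assumes "B \<lhd> G"
  shows "{y \<in> carrier G. \<forall>b\<in>B. y \<otimes> b = b \<otimes> y} \<lhd> G"
proof -
  let ?C = "{y \<in> carrier G. \<forall>b\<in>B. y \<otimes> b = b \<otimes> y}"
  have B: "B \<subseteq> carrier G" using normal_imp_subgroup[OF assms] by (rule subgroup.subset)
  have "subgroup ?C G"
  proof (rule subgroupI)
    have "\<one> \<in> ?C" using B by (auto simp: subset_iff)
    then show "?C \<noteq> {}" by blast
  next
    fix y assume y: "y \<in> ?C"
    have "inv y \<otimes> b = b \<otimes> inv y" if "b \<in> B" for b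
    proof -
      have b: "b \<in> carrier G" "y \<otimes> b = b \<otimes> y" using that y B by auto
      have "inv y \<otimes> (y \<otimes> b) = b" using y b(1) by (simp flip: m_assoc)
      then have "b \<otimes> inv y = inv y \<otimes> (y \<otimes> b) \<otimes> inv y" by (simp only:)
      also have "\<dots> = inv y \<otimes> (b \<otimes> y) \<otimes> inv y" using b by simp
      also have "\<dots> = inv y \<otimes> b" using y b(1) by (simp add: m_assoc)
      finally show ?thesis by simp
    qed
    then show "inv y \<in> ?C" using y by simp
  next
    fix x y assume xy: "x \<in> ?C" "y \<in> ?C"
    have "x \<otimes> y \<otimes> b = b \<otimes> (x \<otimes> y)" if "b \<in> B" for b
    proof -
      have b: "b \<in> carrier G" "y \<otimes> b = b \<otimes> y" "x \<otimes> b = b \<otimes> x" using that xy B by auto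
      have "x \<otimes> y \<otimes> b = x \<otimes> (y \<otimes> b)" using b(1) xy by (simp only: m_assoc mem_Collect_eq)
      also have "\<dots> = x \<otimes> (b \<otimes> y)" by (simp only: b(2))
      also have "\<dots> = x \<otimes> b \<otimes> y" using b(1) xy by (simp only: m_assoc mem_Collect_eq)
      also have "\<dots> = b \<otimes> x \<otimes> y" by (simp only: b(3))
      also have "\<dots> = b \<otimes> (x \<otimes> y)" using b(1) xy by (simp only: m_assoc mem_Collect_eq)
      finally show ?thesis .
    qed
    then show "x \<otimes> y \<in> ?C" using xy by simp
  qed blast
  moreover have "x \<otimes> y \<otimes> inv x \<in> ?C" if x: "x \<in> carrier G" and y: "y \<in> ?C" for x y
  proof -
    have "x \<otimes> y \<otimes> inv x \<otimes> b = b \<otimes> (x \<otimes> y \<otimes> inv x)" if b: "b \<in> B" for b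
    proof -
      let ?b = "inv x \<otimes> b \<otimes> x"
      have bG: "b \<in> carrier G" using b B by auto
      have "?b \<in> B" using normal.inv_op_closed1[OF assms x b] .
      then have comm: "y \<otimes> ?b = ?b \<otimes> y" using y by auto
      have "x \<otimes> y \<otimes> inv x \<otimes> b = x \<otimes> (y \<otimes> ?b) \<otimes> inv x" using x y bG by (simp add: m_assoc)
      also have "\<dots> = x \<otimes> (?b \<otimes> y) \<otimes> inv x" by (simp add: comm)
      also have "\<dots> = x \<otimes> inv x \<otimes> (b \<otimes> (x \<otimes> y \<otimes> inv x))"
        using x y bG by (simp only: m_assoc m_closed inv_closed mem_Collect_eq)
      also have "\<dots> = b \<otimes> (x \<otimes> y \<otimes> inv x)" using x y bG by simp
      finally show ?thesis .
    qed
    then show ?thesis using x y by simp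
  qed
  ultimately show ?thesis by (simp add: normal_inv_iff)
qed

lemma (in group) centralizer_normal:
  assumes "A \<lhd> G" "K \<lhd> G"
  shows "centralizer G A K \<lhd> G"
proof -
  interpret q: group_epi G "G Mod K" "\<lambda>x. K #> x" using assms(2) by (rule quotient_epi)
  let ?C = "{y \<in> carrier (G Mod K). \<forall>b\<in>(\<lambda>x. K #> x) ` A. y \<otimes>\<^bsub>G Mod K\<^esub> b = b \<otimes>\<^bsub>G Mod K\<^esub> y}"
  have "?C \<lhd> G Mod K" using q.normal_image[OF assms(1)] by (rule q.H.commutant_normal)
  then have "{x \<in> carrier G. K #> x \<in> ?C} \<lhd> G" by (rule q.normal_vimage)
  moreover have "{x \<in> carrier G. K #> x \<in> ?C} = centralizer G A K"
  proof (rule Set.set_eqI)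
    fix x
    show "x \<in> {x \<in> carrier G. K #> x \<in> ?C} \<longleftrightarrow> x \<in> centralizer G A K"
      using q.mem_centralizer_iff[OF subgroup.subset[OF normal_imp_subgroup[OF assms(1)]]] q.hom_closed
      unfolding quotient_epi(2)[OF assms(2)] by blast
  qed
  ultimately show ?thesis by simp
qed

lemma (in group_epi) centralizer_image:
  assumes "A \<lhd> G" "K \<lhd> G" "kernel G H h \<subseteq> K"
  shows "kernel G H h \<subseteq> centralizer G A K" "h ` centralizer G A K = centralizer H (h ` A) (h ` K)"
proof -
  have K': "h ` K \<lhd> H" using assms(2) by (rule normal_image)
  let ?q = "\<lambda>x. h ` K #>\<^bsub>H\<^esub> x" and ?Q = "H Mod (h ` K)"
  interpret q: group_epi H ?Q ?q using K' by (rule quotient_epi)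
  have kq: "kernel H ?Q ?q = h ` K" using K' by (rule quotient_epi)
  interpret qh: group_epi G ?Q "?q \<circ> h" by (rule comp[OF q.group_epi_axioms])
  have "kernel G ?Q (?q \<circ> h) = {x \<in> carrier G. h x \<in> kernel H ?Q ?q}"
    by (auto simp: kernel_def)
  also have "\<dots> = K" unfolding kq by (rule vimage_image[OF normal_imp_subgroup[OF assms(2)] assms(3)])
  finally have kqh: "kernel G ?Q (?q \<circ> h) = K" .
  have A: "A \<subseteq> carrier G" using normal_imp_subgroup[OF assms(1)] by (rule subgroup.subset)
  have hA: "h ` A \<subseteq> carrier H" using A by auto
  have iff: "g \<in> centralizer G A K \<longleftrightarrow> g \<in> carrier G \<and> h g \<in> centralizer H (h ` A) (h ` K)" for g
    using qh.mem_centralizer_iff[OF A, of g] q.mem_centralizer_iff[OF hA, of "h g"]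
    unfolding kqh kq by auto
  have sub: "subgroup (centralizer H (h ` A) (h ` K)) H"
    using H.centralizer_normal[OF normal_image[OF assms(1)] K'] by (rule normal_imp_subgroup)
  show "kernel G H h \<subseteq> centralizer G A K"
  proof
    fix x assume "x \<in> kernel G H h"
    then have "x \<in> carrier G" "h x = \<one>\<^bsub>H\<^esub>" by (auto simp: kernel_def)
    then show "x \<in> centralizer G A K" unfolding iff using subgroup.one_closed[OF sub] by simp
  qed
  have "centralizer G A K = {g \<in> carrier G. h g \<in> centralizer H (h ` A) (h ` K)}" using iff by blast
  then show "h ` centralizer G A K = centralizer H (h ` A) (h ` K)"
    using image_vimage[OF subgroup.subset[OF sub]] by simp
qed

lemma (in group) factor_group:
  assumes "A \<lhd> G" "K \<lhd> G" "K \<subseteq> A"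
  shows "K \<lhd> G\<lparr>carrier := A\<rparr>" "group (factor G A K)"
    "finite (carrier G) \<Longrightarrow> finite (carrier (factor G A K))"
proof -
  have A: "subgroup A G" using assms(1) by (rule normal_imp_subgroup)
  show K: "K \<lhd> G\<lparr>carrier := A\<rparr>"
    using assms(2,3) subgroup.subset[OF A] by (auto simp: normal_in_subgroup_iff[OF A] normal_inv_iff)
  show "group (factor G A K)" unfolding factor_def using K by (rule normal.factorgroup_is_group)
  show "finite (carrier (factor G A K))" if "finite (carrier G)"
    unfolding factor_def using that subgroup.subset[OF A] finite_subset
    by (intro finite_quotient) auto
qed

lemma (in group) chief_factor_group:
  assumes "chief_factor G A K"
  shows "A \<lhd> G" "K \<lhd> G" "K \<subseteq> A" "group (factor G A K)" "carrier (factor G A K) \<noteq> {\<one>\<^bsub>factor G A K\<^esub>}"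
proof -
  show A: "A \<lhd> G" "K \<lhd> G" "K \<subseteq> A" using assms by (auto simp: chief_factor_def)
  show "group (factor G A K)" using factor_group[OF A] by simp
  show "carrier (factor G A K) \<noteq> {\<one>\<^bsub>factor G A K\<^esub>}"
  proof
    assume *: "carrier (factor G A K) = {\<one>\<^bsub>factor G A K\<^esub>}"
    have "a \<in> K" if a: "a \<in> A" for a
    proof -
      have "K #> a = K" using * a by (auto simp: factor_def carrier_FactGroup)
      moreover have "a \<in> carrier G" using a subgroup.subset[OF normal_imp_subgroup[OF A(1)]] by blast
      ultimately show ?thesis using coset_join1 normal_imp_subgroup[OF A(2)] subgroup.subset by blast
    qed
    then show False using assms by (auto simp: chief_factor_def)
  qed
qed

lemma (in group) chief_factor_Com_iso:
  assumes "finite (carrier G)" "chief_factor G A K"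
    and "S \<in> Com (factor G A K)" "T \<in> Com (factor G A K)"
  shows "S \<cong> T"
proof -
  note cf = chief_factor_group[OF assms(2)]
  interpret q: group_epi G "G Mod K" "\<lambda>x. K #> x" using cf(2) by (rule quotient_epi)
  have k: "kernel G (G Mod K) (\<lambda>x. K #> x) = K" using cf(2) by (rule quotient_epi)
  let ?A = "(\<lambda>x. K #> x) ` A"
  have "(\<lambda>x. K #> x) ` K = {\<one>\<^bsub>G Mod K\<^esub>}"
  proof -
    have "(\<lambda>x. K #> x) ` kernel G (G Mod K) (\<lambda>x. K #> x) \<subseteq> {\<one>\<^bsub>G Mod K\<^esub>}" unfolding kernel_def by blast
    moreover have "\<one> \<in> K" using normal_imp_subgroup[OF cf(2)] by (rule subgroup.one_closed)
    ultimately show ?thesis unfolding k by blast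
  qed
  then have min: "minimal_normal ?A (G Mod K)"
    using q.chief_factor_image[OF assms(2)] k q.H.minimal_normal_iff_chief_factor by simp
  have sA: "subgroup A G" using cf(1) by (rule normal_imp_subgroup)
  interpret r: group_epi "G\<lparr>carrier := A\<rparr>" "(G Mod K)\<lparr>carrier := ?A\<rparr>" "\<lambda>x. K #> x"
    using sA by (rule q.restrict_epi)
  have "kernel (G\<lparr>carrier := A\<rparr>) ((G Mod K)\<lparr>carrier := ?A\<rparr>) (\<lambda>x. K #> x) =
      A \<inter> kernel G (G Mod K) (\<lambda>x. K #> x)"
    using subgroup.subset[OF sA] by (auto simp: kernel_def)
  also have "\<dots> = K" using k cf(3) by auto
  finally have "factor G A K \<cong> (G Mod K)\<lparr>carrier := ?A\<rparr>"
    using r.quotient_iso by (simp add: factor_def)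
  then have "Com (factor G A K) = Com ((G Mod K)\<lparr>carrier := ?A\<rparr>)"
    using Com_iso[OF cf(4) r.H.is_group] factor_group[OF cf(1-3)] assms(1) by blast
  then show ?thesis
    using Com_minimal_normal_iso[OF q.H.is_group finite_quotient[OF assms(1)] min] assms(3,4) by simp
qed

text \<open>
  The normal subgroups that generate the small centralizer downstairs are the images of those upstairs,
  because \<open>NK/K\<close> and its image are isomorphic. The kernel is contained in the small centralizer, since
  \<open>K\<close> itself is one of the generating subgroups.
\<close>

lemma (in group_epi) small_centralizer_image:
  assumes "finite (carrier G)" "A \<lhd> G" "K \<lhd> G" "K \<subseteq> A" "kernel G H h \<subseteq> K"
  shows "small_centralizer G A K \<lhd> G" "kernel G H h \<subseteq> small_centralizer G A K"
    "h ` small_centralizer G A K = small_centralizer H (h ` A) (h ` K)"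
proof -
  let ?N = "{N. N \<lhd> G \<and> Com (factor G (N <#> K) K) \<inter> Com (factor G A K) = {}}"
  let ?N' = "{N. N \<lhd> H \<and> Com (factor H (N <#>\<^bsub>H\<^esub> h ` K) (h ` K)) \<inter> Com (factor H (h ` A) (h ` K)) = {}}"
  have UN: "\<Union>?N \<subseteq> carrier G" using normal_imp_subgroup[THEN subgroup.subset] by auto
  show "small_centralizer G A K \<lhd> G"
    unfolding small_centralizer_def
    by (rule G.normal_generateI[OF UN]) (auto simp: G.normal_inv_iff)
  have sK: "subgroup K G" using assms(3) by (rule normal_imp_subgroup)
  have KK: "K \<lhd> G\<lparr>carrier := K\<rparr>" "group (factor G K K)" using G.factor_group[OF assms(3,3)] by auto
  have "carrier (factor G K K) = {\<one>\<^bsub>factor G K K\<^esub>}"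
    using subgroup.one_closed[OF sK] G.coset_join2[OF _ sK] subgroup.subset[OF sK]
    by (auto simp: factor_def carrier_FactGroup)
  then have "Com (factor G K K) = {}" using group.Com_trivial[OF KK(2)] by simp
  then have "K \<in> ?N" using assms(3) G.subgroup_mult_id[OF sK] by simp
  moreover have "\<Union>?N \<subseteq> generate G (\<Union>?N)" using generate.incl[of _ "\<Union>?N" G] by blast
  ultimately show "kernel G H h \<subseteq> small_centralizer G A K"
    unfolding small_centralizer_def using assms(5) by blast
  have Com_eq: "Com (factor G B K) = Com (factor H (h ` B) (h ` K))" if B: "B \<lhd> G" "K \<subseteq> B" for B
  proof (rule Com_iso)
    note f = G.factor_group[OF B(1) assms(3) B(2)]
    show "group (factor G B K)" "finite (carrier (factor G B K))" using f assms(1) by auto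
    show "group (factor H (h ` B) (h ` K))"
      using H.factor_group(2)[OF normal_image[OF B(1)] normal_image[OF assms(3)]] B(2) by blast
    show "factor G B K \<cong> factor H (h ` B) (h ` K)"
      using normal_imp_subgroup[OF B(1)] f(1) assms(5) by (rule factor_image_iso)
  qed
  have mem: "h ` N \<in> ?N' \<longleftrightarrow> N \<in> ?N" if N: "N \<lhd> G" for N
  proof -
    have "h ` (N <#> K) = h ` N <#>\<^bsub>H\<^esub> h ` K"
      using set_mult_hom[OF homh] normal_imp_subgroup[OF N] sK subgroup.subset by blast
    then have "Com (factor G (N <#> K) K) = Com (factor H (h ` N <#>\<^bsub>H\<^esub> h ` K) (h ` K))"
      using Com_eq[OF G.normal_subgroup_set_mult_closed[OF N assms(3)] G.mem_set_mult_normal(2)[OF N assms(3)]]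
      by simp
    then show ?thesis using N normal_image[OF N] Com_eq[OF assms(2,4)] by simp
  qed
  have "(\<lambda>N. h ` N) ` ?N = ?N'"
  proof (intro equalityI subsetI)
    fix M assume "M \<in> (\<lambda>N. h ` N) ` ?N"
    then obtain N where "N \<in> ?N" "M = h ` N" by (rule imageE)
    then show "M \<in> ?N'" using mem[of N] by simp
  next
    fix M assume M: "M \<in> ?N'"
    let ?V = "{x \<in> carrier G. h x \<in> M}"
    have Mn: "M \<lhd> H" using M by simp
    have "h ` ?V = M" by (rule image_vimage[OF subgroup.subset[OF normal_imp_subgroup[OF Mn]]])
    then show "M \<in> (\<lambda>N. h ` N) ` ?N" using mem[OF normal_vimage[OF Mn]] M by (intro image_eqI[of _ _ ?V]) simp_all
  qed
  then have "\<Union>?N' = h ` \<Union>?N" by (metis image_Union)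
  then show "h ` small_centralizer G A K = small_centralizer H (h ` A) (h ` K)"
    unfolding small_centralizer_def using generate_img[OF UN] by simp
qed

section \<open>Invariance of the defining conditions under epimorphisms\<close>

lemma belongs_iso:
  assumes "group A" "A \<cong> B" shows "A \<in>\<^sub>c F \<longleftrightarrow> B \<in>\<^sub>c F"
  unfolding belongs_def using iso_trans[OF group.iso_sym[OF assms]] iso_trans[OF assms(2)] by blast

lemma belongs_Ecl_iff:
  assumes "group A" "finite (carrier A)" shows "A \<in>\<^sub>c Ecl L \<longleftrightarrow> Com A \<subseteq> L"
proof
  assume "A \<in>\<^sub>c Ecl L"
  then obtain H where H: "H \<in> Ecl L" "A \<cong> H" by (auto simp: belongs_def)
  then have "Com A = Com H"
    by (intro Com_iso assms) (simp_all add: Ecl_def finite_groups_def)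
  then show "Com A \<subseteq> L" using H(1) by (simp add: Ecl_def)
next
  assume "Com A \<subseteq> L"
  note c = nat_copy[OF assms]
  have "nat_copy A \<in> Ecl L"
    using c assms(2) iso_finite[OF c(2)] Com_iso[OF assms(1) c(1) assms(2) c(2)] \<open>Com A \<subseteq> L\<close>
    by (simp add: Ecl_def finite_groups_def)
  then show "A \<in>\<^sub>c Ecl L" using c(2) unfolding belongs_def by blast
qed

lemma iso_trivial_carrier:
  assumes "group A" "group B" "A \<cong> B"
  shows "carrier A = {\<one>\<^bsub>A\<^esub>} \<longleftrightarrow> carrier B = {\<one>\<^bsub>B\<^esub>}"
  using group.order_one_triv_iff[OF assms(1)] group.order_one_triv_iff[OF assms(2)]
    iso_same_card[OF assms(3)] by (simp add: order_def)

lemma nat_copy_nonidentity: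
  assumes "group A" "finite (carrier A)" "carrier A \<noteq> {\<one>\<^bsub>A\<^esub>}"
  shows "nat_copy A \<in> finite_groups" "nonidentity (nat_copy A)" "Com (nat_copy A) = Com A"
  using nat_copy[OF assms(1,2)] iso_finite[OF nat_copy(2)[OF assms(1,2)]] assms
    iso_trivial_carrier[OF assms(1) nat_copy[OF assms(1,2)]] Com_iso[OF assms(1) nat_copy(1)[OF assms(1,2)] assms(2)]
  by (auto simp: finite_groups_def nonidentity_def)

lemma satellite_nat_copy_eq:
  assumes "composition_satellite L f" "group A" "finite (carrier A)" "carrier A \<noteq> {\<one>\<^bsub>A\<^esub>}"
    and "B \<in> finite_groups" "nonidentity B" "Com A = Com B"
  shows "f (nat_copy A) = f B"
  using assms(1) nat_copy_nonidentity[OF assms(2-4)] assms(5-7)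
  unfolding composition_satellite_def by metis

lemma (in group_epi) chief_factor_invariance:
  assumes "finite (carrier G)" "chief_factor G A K" "kernel G H h \<subseteq> K"
  shows "factor G A K \<cong> factor H (h ` A) (h ` K)"
    and "G Mod centralizer G A K \<cong> H Mod centralizer H (h ` A) (h ` K)"
    and "G Mod small_centralizer G A K \<cong> H Mod small_centralizer H (h ` A) (h ` K)"
proof -
  note cf = G.chief_factor_group[OF assms(2)]
  show "factor G A K \<cong> factor H (h ` A) (h ` K)"
    using normal_imp_subgroup[OF cf(1)] G.factor_group(1)[OF cf(1-3)] assms(3) by (rule factor_image_iso)
  show "G Mod centralizer G A K \<cong> H Mod centralizer H (h ` A) (h ` K)"
    using quotient_image_iso[OF G.centralizer_normal[OF cf(1,2)]] centralizer_image[OF cf(1,2) assms(3)] by simp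
  show "G Mod small_centralizer G A K \<cong> H Mod small_centralizer H (h ` A) (h ` K)"
    using quotient_image_iso small_centralizer_image[OF assms(1) cf(1-3) assms(3)] by metis
qed

lemma (in group_epi) f_central_iff:
  assumes "composition_satellite L f" "finite (carrier G)" "chief_factor G A K" "kernel G H h \<subseteq> K"
  shows "f_central L f G A K \<longleftrightarrow> f_central L f H (h ` A) (h ` K)"
proof -
  have finH: "finite (carrier H)" using assms(2) by (simp flip: surj)
  note cf = G.chief_factor_group[OF assms(3)]
  note cfH = H.chief_factor_group[OF chief_factor_image[OF assms(3,4)]]
  note finf = G.factor_group(3)[OF cf(1-3) assms(2)]
  note finfH = H.factor_group(3)[OF cfH(1-3) finH]
  note inv = chief_factor_invariance[OF assms(2-4)]
  note Com = Com_iso[OF cf(4) cfH(4) finf inv(1)]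
  have "f (nat_copy (factor G A K)) = f (nat_copy (factor H (h ` A) (h ` K)))"
    using satellite_nat_copy_eq[OF assms(1) cf(4) finf cf(5)]
      nat_copy_nonidentity[OF cfH(4) finfH cfH(5)] Com by simp
  moreover have "factor G A K \<in>\<^sub>c M \<longleftrightarrow> factor H (h ` A) (h ` K) \<in>\<^sub>c M" for M
    using cf(4) inv(1) by (rule belongs_iso)
  moreover have "G Mod centralizer G A K \<in>\<^sub>c M \<longleftrightarrow> H Mod centralizer H (h ` A) (h ` K) \<in>\<^sub>c M" for M
    using normal.factorgroup_is_group[OF G.centralizer_normal[OF cf(1,2)]] inv(2) by (rule belongs_iso)
  moreover have "G Mod small_centralizer G A K \<in>\<^sub>c M \<longleftrightarrow> H Mod small_centralizer H (h ` A) (h ` K) \<in>\<^sub>c M" for M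
    using normal.factorgroup_is_group[OF small_centralizer_image(1)[OF assms(2) cf(1-3) assms(4)]] inv(3)
    by (rule belongs_iso)
  ultimately show ?thesis unfolding f_central_def by simp
qed

text \<open>
  Clause (i) in the definition of a local formation, for a single chief factor.
\<close>

definition chief_condition ::
  "grp_class \<Rightarrow> (nat + nat monoid \<Rightarrow> grp_class) \<Rightarrow> ('a, 'b) monoid_scheme \<Rightarrow> 'a set \<Rightarrow> 'a set \<Rightarrow> bool" where
  "chief_condition X f G H K \<longleftrightarrow> (factor G H K \<in>\<^sub>c Ecl X \<longrightarrow>
     (\<forall>p\<in>primes_of (factor G H K). G Mod centralizer G H K \<in>\<^sub>c f (Inl p)))"

text \<open>
  Clause (ii) in the definition of a local formation, for a single quotient \<open>Q\<close>.
\<close>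

definition monolith_condition ::
  "grp_class \<Rightarrow> (nat + nat monoid \<Rightarrow> grp_class) \<Rightarrow> ('a, 'b) monoid_scheme \<Rightarrow> bool" where
  "monolith_condition X f Q \<longleftrightarrow>
     (monolithic Q \<and> Q\<lparr>carrier := Soc Q\<rparr> \<in>\<^sub>c Ecl (compl_class X) \<longrightarrow>
        (\<forall>S\<in>Com (Q\<lparr>carrier := Soc Q\<rparr>). Q \<in>\<^sub>c f (Inr S)))"

lemma mem_LF_iff:
  "G \<in> LF X f \<longleftrightarrow> G \<in> finite_groups \<and>
     (\<forall>H K. chief_factor G H K \<longrightarrow> chief_condition X f G H K) \<and>
     (\<forall>N. N \<lhd> G \<longrightarrow> monolith_condition X f (G Mod N))"
  unfolding LF_def chief_condition_def monolith_condition_def by blast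

lemma (in group_epi) chief_condition_iff:
  assumes "finite (carrier G)" "chief_factor G A K" "kernel G H h \<subseteq> K"
  shows "chief_condition X f G A K \<longleftrightarrow> chief_condition X f H (h ` A) (h ` K)"
proof -
  note cf = G.chief_factor_group[OF assms(2)]
  note inv = chief_factor_invariance[OF assms]
  have "factor G A K \<in>\<^sub>c M \<longleftrightarrow> factor H (h ` A) (h ` K) \<in>\<^sub>c M" for M
    using cf(4) inv(1) by (rule belongs_iso)
  moreover have "G Mod centralizer G A K \<in>\<^sub>c M \<longleftrightarrow> H Mod centralizer H (h ` A) (h ` K) \<in>\<^sub>c M" for M
    using normal.factorgroup_is_group[OF G.centralizer_normal[OF cf(1,2)]] inv(2) by (rule belongs_iso)
  moreover have "primes_of (factor G A K) = primes_of (factor H (h ` A) (h ` K))"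
    using iso_same_card[OF inv(1)] by (simp add: primes_of_def order_def)
  ultimately show ?thesis unfolding chief_condition_def by simp
qed

lemma Soc_iso:
  assumes "group A" "group B" "A \<cong> B"
  shows "A\<lparr>carrier := Soc A\<rparr> \<cong> B\<lparr>carrier := Soc B\<rparr>" "monolithic A \<longleftrightarrow> monolithic B"
proof -
  obtain h where h: "group_epi A B h" "kernel A B h = {\<one>\<^bsub>A\<^esub>}" using iso_epi[OF assms] .
  interpret h: group_epi A B h by fact
  let ?V = "\<lambda>N. {x \<in> carrier A. h x \<in> N}"
  have img: "minimal_normal (h ` N) B" if "minimal_normal N A" for N
    using h.chief_factor_image[of N "{\<one>\<^bsub>A\<^esub>}"] that h(2)
    by (simp add: h.G.minimal_normal_iff_chief_factor h.H.minimal_normal_iff_chief_factor)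
  have V1: "?V {\<one>\<^bsub>B\<^esub>} = {\<one>\<^bsub>A\<^esub>}" using h(2) by (simp add: kernel_def)
  have vimg: "minimal_normal (?V N) A" "h ` ?V N = N" if "minimal_normal N B" for N
  proof -
    show "minimal_normal (?V N) A"
      using h.chief_factor_vimage[of N "{\<one>\<^bsub>B\<^esub>}"] that V1
      by (simp add: h.G.minimal_normal_iff_chief_factor h.H.minimal_normal_iff_chief_factor)
    show "h ` ?V N = N"
      using that by (intro h.image_vimage subgroup.subset normal_imp_subgroup) (simp add: minimal_normal_def)
  qed
  have V_img: "?V (h ` N) = N" if "minimal_normal N A" for N
  proof (rule h.vimage_image)
    show sN: "subgroup N A" using that by (simp add: minimal_normal_def normal_imp_subgroup)
    show "kernel A B h \<subseteq> N" using h(2) subgroup.one_closed[OF sN] by simp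
  qed
  have "(\<lambda>N. h ` N) ` {N. minimal_normal N A} = {N. minimal_normal N B}"
  proof (intro equalityI subsetI)
    fix M assume "M \<in> {N. minimal_normal N B}"
    then show "M \<in> (\<lambda>N. h ` N) ` {N. minimal_normal N A}"
      using vimg[of M] by (intro image_eqI[of _ _ "?V M"]) simp_all
  qed (use img in blast)
  then have U: "\<Union>{N. minimal_normal N B} = h ` \<Union>{N. minimal_normal N A}" by (metis image_Union)
  have UA: "\<Union>{N. minimal_normal N A} \<subseteq> carrier A"
    by (auto simp: minimal_normal_def dest!: normal_imp_subgroup[THEN subgroup.subset])
  have Soc: "Soc B = h ` Soc A" unfolding Soc_def U by (rule h.generate_img[OF UA])
  have sub: "subgroup (Soc A) A" unfolding Soc_def using UA by (rule h.G.generate_is_subgroup)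
  interpret r: group_epi "A\<lparr>carrier := Soc A\<rparr>" "B\<lparr>carrier := Soc B\<rparr>" h
    using h.restrict_epi[OF sub] unfolding Soc .
  have "kernel (A\<lparr>carrier := Soc A\<rparr>) (B\<lparr>carrier := Soc B\<rparr>) h = {\<one>\<^bsub>A\<^esub>}"
    using h(2) subgroup.subset[OF sub] subgroup.one_closed[OF sub] by (auto simp: kernel_def)
  then have "h \<in> iso (A\<lparr>carrier := Soc A\<rparr>) (B\<lparr>carrier := Soc B\<rparr>)"
    using iso_kernel_image[OF r.G.is_group r.H.is_group] r.homh r.surj by simp
  then show "A\<lparr>carrier := Soc A\<rparr> \<cong> B\<lparr>carrier := Soc B\<rparr>" by (rule is_isoI)
  show "monolithic A \<longleftrightarrow> monolithic B"
  proof
    assume "monolithic A"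
    then obtain N where N: "minimal_normal N A" "\<And>M. minimal_normal M A \<Longrightarrow> M = N"
      unfolding monolithic_def by blast
    show "monolithic B" unfolding monolithic_def
    proof (rule ex1I[of _ "h ` N"])
      show "minimal_normal (h ` N) B" using N(1) by (rule img)
      fix M assume M: "minimal_normal M B"
      have "?V M = N" using vimg(1)[OF M] by (rule N(2))
      then show "M = h ` N" using vimg(2)[OF M] by simp
    qed
  next
    assume "monolithic B"
    then obtain N where N: "minimal_normal N B" "\<And>M. minimal_normal M B \<Longrightarrow> M = N"
      unfolding monolithic_def by blast
    show "monolithic A" unfolding monolithic_def
    proof (rule ex1I[of _ "?V N"])
      show "minimal_normal (?V N) A" using N(1) by (rule vimg)
      fix M assume M: "minimal_normal M A"
      have "h ` M = N" using img[OF M] by (rule N(2))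
      then show "M = ?V N" using V_img[OF M] by simp
    qed
  qed
qed

lemma (in group) Soc_subgroup: "subgroup (Soc G) G"
proof -
  have "\<Union>{N. minimal_normal N G} \<subseteq> carrier G"
    by (auto simp: minimal_normal_def dest!: normal_imp_subgroup[THEN subgroup.subset])
  then show ?thesis unfolding Soc_def by (rule generate_is_subgroup)
qed

lemma monolith_condition_iso:
  assumes "group A" "group B" "finite (carrier A)" "A \<cong> B"
  shows "monolith_condition X f A \<longleftrightarrow> monolith_condition X f B"
proof -
  interpret A: group A by fact
  interpret B: group B by fact
  note Soc = Soc_iso[OF assms(1,2,4)]
  have gA: "group (A\<lparr>carrier := Soc A\<rparr>)" using A.Soc_subgroup by (rule A.subgroup_imp_group)
  have gB: "group (B\<lparr>carrier := Soc B\<rparr>)" using B.Soc_subgroup by (rule B.subgroup_imp_group)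
  have "finite (carrier (A\<lparr>carrier := Soc A\<rparr>))"
    using subgroup.subset[OF A.Soc_subgroup] assms(3) finite_subset by auto
  then have "Com (A\<lparr>carrier := Soc A\<rparr>) = Com (B\<lparr>carrier := Soc B\<rparr>)"
    using Com_iso[OF gA gB _ Soc(1)] by blast
  then show ?thesis
    unfolding monolith_condition_def Soc(2) using belongs_iso[OF gA Soc(1)] belongs_iso[OF assms(1,4)] by simp
qed

lemma LF_epi_closed:
  assumes "G \<in> LF X f" "group_epi G H h"
  shows "H \<in> LF X f"
proof -
  interpret group_epi G H h by fact
  have finG: "finite (carrier G)" using assms(1) by (simp add: LF_def finite_groups_def)
  then have finH: "finite (carrier H)" by (simp flip: surj)
  have G: "\<And>A K. chief_factor G A K \<Longrightarrow> chief_condition X f G A K"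
    "\<And>N. N \<lhd> G \<Longrightarrow> monolith_condition X f (G Mod N)" using assms(1) by (auto simp: mem_LF_iff)
  have ker: "kernel G H h \<subseteq> {x \<in> carrier G. h x \<in> K}" "h ` {x \<in> carrier G. h x \<in> K} = K" if "K \<lhd> H" for K
    using subgroup.one_closed[OF normal_imp_subgroup[OF that]]
      image_vimage[OF subgroup.subset[OF normal_imp_subgroup[OF that]]] by (auto simp: kernel_def)
  have "chief_condition X f H A K" if c: "chief_factor H A K" for A K
  proof -
    note cf = H.chief_factor_group[OF c]
    show ?thesis
      using chief_condition_iff[OF finG chief_factor_vimage[OF c] ker(1)[OF cf(2)]]
        G(1)[OF chief_factor_vimage[OF c]] ker(2)[OF cf(1)] ker(2)[OF cf(2)] by simp
  qed
  moreover have "monolith_condition X f (H Mod N)" if N: "N \<lhd> H" for N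
  proof -
    let ?V = "{x \<in> carrier G. h x \<in> N}"
    have V: "?V \<lhd> G" using N by (rule normal_vimage)
    have "G Mod ?V \<cong> H Mod N" using quotient_image_iso[OF V ker(1)[OF N]] ker(2)[OF N] by simp
    then show ?thesis
      using monolith_condition_iso[OF normal.factorgroup_is_group[OF V] normal.factorgroup_is_group[OF N]
          finite_quotient[OF finG]] G(2)[OF V] by blast
  qed
  ultimately show ?thesis using finH H.is_group by (simp add: mem_LF_iff finite_groups_def)
qed

lemma CF_epi_closed:
  assumes "composition_satellite L f" "G \<in> CF L f" "group_epi G H h"
  shows "H \<in> CF L f"
proof -
  interpret group_epi G H h by fact
  have finG: "finite (carrier G)" using assms(2) by (simp add: CF_def finite_groups_def)
  then have finH: "finite (carrier H)" by (simp flip: surj)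
  have ker: "kernel G H h \<subseteq> {x \<in> carrier G. h x \<in> K}" "h ` {x \<in> carrier G. h x \<in> K} = K" if "K \<lhd> H" for K
    using subgroup.one_closed[OF normal_imp_subgroup[OF that]]
      image_vimage[OF subgroup.subset[OF normal_imp_subgroup[OF that]]] by (auto simp: kernel_def)
  have "f_central L f H A K" if c: "chief_factor H A K" for A K
  proof -
    note cf = H.chief_factor_group[OF c]
    have "f_central L f G {x \<in> carrier G. h x \<in> A} {x \<in> carrier G. h x \<in> K}"
      using assms(2) chief_factor_vimage[OF c] by (simp add: CF_def)
    then show ?thesis
      using f_central_iff[OF assms(1) finG chief_factor_vimage[OF c] ker(1)[OF cf(2)]]
        ker(2)[OF cf(1)] ker(2)[OF cf(2)] by simp
  qed
  then show ?thesis using finH H.is_group by (simp add: CF_def finite_groups_def)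
qed

section \<open>Monolithic groups and membership in a formation\<close>

lemma formation_group_class: "formation F \<Longrightarrow> group_class F"
  by (simp add: formation_def)

lemma formation_epi:
  assumes "formation F" "finite (carrier G)" "G \<in>\<^sub>c F" "group_epi G H h"
  shows "H \<in>\<^sub>c F"
proof -
  interpret group_epi G H h by fact
  have finH: "finite (carrier H)" using assms(2) by (simp flip: surj)
  note c = nat_copy[OF H.is_group finH]
  obtain G' where G': "G' \<in> F" "G \<cong> G'" using assms(3) by (auto simp: belongs_def)
  have grp: "group G'" using G'(1) formation_group_class[OF assms(1)] by (auto simp: group_class_def finite_groups_def)
  obtain k where "group_epi G' G k" using iso_epi[OF grp G.is_group G.iso_sym[OF G'(2)]] .
  from group_epi.comp[OF this group_epi_axioms] have e: "group_epi G' H (h \<circ> k)" .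
  obtain c' where "group_epi H (nat_copy H) c'" using iso_epi[OF H.is_group c] .
  from group_epi.epi[OF group_epi.comp[OF e this]] have "nat_copy H \<in> F"
    using assms(1) G'(1) c(1) unfolding formation_def by blast
  then show ?thesis using c(2) by (auto simp: belongs_def)
qed

lemma formation_trivial:
  assumes "formation F" "F \<noteq> {}" "group G" "carrier G = {\<one>\<^bsub>G\<^esub>}"
  shows "G \<in>\<^sub>c F"
proof -
  obtain A where A: "A \<in> F" using assms(2) by blast
  then have A': "group A" "finite (carrier A)"
    using formation_group_class[OF assms(1)] by (auto simp: group_class_def finite_groups_def)
  interpret A: group A by fact
  interpret group G by fact
  have "(\<lambda>x. \<one>\<^bsub>G\<^esub>) ` carrier A = carrier G" using assms(4) A.one_closed by auto
  then have "group_epi A G (\<lambda>x. \<one>\<^bsub>G\<^esub>)" by (intro group_epiI) (auto simp: epi_def hom_def)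
  moreover have "A \<in>\<^sub>c F" using A iso_refl[of A] unfolding belongs_def by blast
  ultimately show ?thesis using formation_epi[OF assms(1) A'(2)] by blast
qed

lemma quotient_belongs_epi:
  assumes "group_class F" "N \<lhd> G" "G Mod N \<in>\<^sub>c F"
  obtains A h where "A \<in> F" "group_epi G A h" "kernel G A h = N"
proof -
  interpret q: group_epi G "G Mod N" "\<lambda>x. N #>\<^bsub>G\<^esub> x" using assms(2) by (rule quotient_epi)
  obtain A where A: "A \<in> F" "G Mod N \<cong> A" using assms(3) by (auto simp: belongs_def)
  have grp: "group A" using A(1) assms(1) by (auto simp: group_class_def finite_groups_def)
  obtain k where k: "group_epi (G Mod N) A k" "kernel (G Mod N) A k = {\<one>\<^bsub>G Mod N\<^esub>}"
    using iso_epi[OF q.H.is_group grp A(2)] .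
  have "kernel G A (k \<circ> (\<lambda>x. N #>\<^bsub>G\<^esub> x)) = {x \<in> carrier G. N #>\<^bsub>G\<^esub> x \<in> kernel (G Mod N) A k}"
    by (auto simp: kernel_def carrier_FactGroup)
  also have "\<dots> = kernel G (G Mod N) (\<lambda>x. N #>\<^bsub>G\<^esub> x)" unfolding k(2) by (simp add: kernel_def)
  also have "\<dots> = N" using assms(2) by (rule quotient_epi)
  finally show thesis using that[OF A(1) q.comp[OF k(1)]] by blast
qed

text \<open>
  The group embeds into the product of its two quotients, onto each of which it projects.
\<close>

lemma formation_subdirect:
  assumes "formation F" "group G" "finite (carrier G)" "N\<^sub>1 \<lhd> G" "N\<^sub>2 \<lhd> G" "N\<^sub>1 \<inter> N\<^sub>2 = {\<one>\<^bsub>G\<^esub>}"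
    and "G Mod N\<^sub>1 \<in>\<^sub>c F" "G Mod N\<^sub>2 \<in>\<^sub>c F"
  shows "G \<in>\<^sub>c F"
proof -
  interpret group G by fact
  obtain A\<^sub>1 h\<^sub>1 where 1: "A\<^sub>1 \<in> F" "group_epi G A\<^sub>1 h\<^sub>1" "kernel G A\<^sub>1 h\<^sub>1 = N\<^sub>1" using quotient_belongs_epi[OF formation_group_class[OF assms(1)] assms(4,7)] .
  obtain A\<^sub>2 h\<^sub>2 where 2: "A\<^sub>2 \<in> F" "group_epi G A\<^sub>2 h\<^sub>2" "kernel G A\<^sub>2 h\<^sub>2 = N\<^sub>2" using quotient_belongs_epi[OF formation_group_class[OF assms(1)] assms(5,8)] .
  interpret h1: group_epi G A\<^sub>1 h\<^sub>1 by fact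
  interpret h2: group_epi G A\<^sub>2 h\<^sub>2 by fact
  \<comment> \<open>The diagonal map into the product of the two quotients is injective because the kernels intersect trivially.\<close>
  define I :: "nat set" where "I = {0, 1}"
  define A where "A i = (if i = (0::nat) then A\<^sub>1 else A\<^sub>2)" for i
  define h where "h x = (\<lambda>i\<in>I. if i = 0 then h\<^sub>1 x else h\<^sub>2 x)" for x
  have grpP: "group (product_group I A)"
    by (intro product_group) (simp add: A_def)
  have "h \<in> hom G (product_group I A)"
    by (rule homI) (auto simp: h_def A_def fun_eq_iff)
  then interpret h: group_hom G "product_group I A" h
    using grpP is_group by (simp only: group_hom_def group_hom_axioms_def simp_thms)
  have "subgroup (h ` carrier G) (product_group I A)" by (rule h.img_is_subgroup)
  moreover have "(\<lambda>x. x i) ` h ` carrier G = carrier (A i)" if "i \<in> I" for i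
    unfolding image_image using that
    by (cases "i = 0") (simp_all add: h_def A_def h1.surj h2.surj)
  ultimately have "(product_group I A)\<lparr>carrier := h ` carrier G\<rparr> \<in>\<^sub>c F"
    using assms(1) 1(1) 2(1) unfolding formation_def I_def A_def by simp
  moreover have "kernel G ((product_group I A)\<lparr>carrier := h ` carrier G\<rparr>) h = {\<one>\<^bsub>G\<^esub>}"
  proof -
    have "x \<in> N\<^sub>1 \<inter> N\<^sub>2" if x: "x \<in> carrier G" "h x = \<one>\<^bsub>product_group I A\<^esub>" for x
    proof -
      have "h x 0 = \<one>\<^bsub>product_group I A\<^esub> 0" "h x 1 = \<one>\<^bsub>product_group I A\<^esub> 1" using x(2) by auto
      then show ?thesis unfolding 1(3)[symmetric] 2(3)[symmetric]
        using x(1) by (simp add: kernel_def h_def A_def I_def)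
    qed
    moreover have "h \<one>\<^bsub>G\<^esub> = \<one>\<^bsub>product_group I A\<^esub>" by (rule h.hom_one)
    ultimately show ?thesis unfolding assms(6) by (auto simp: kernel_def simp del: one_product_group)
  qed
  then have "G \<cong> (product_group I A)\<lparr>carrier := h ` carrier G\<rparr>"
    using iso_kernel_image[OF is_group h.H.subgroup_imp_group[OF h.img_is_subgroup]] h.homh
    by (intro is_isoI[of h]) (auto simp: hom_def)
  ultimately show ?thesis using belongs_iso[OF is_group] by blast
qed

text \<open>
  Induction on the order of \<open>G\<close>. All quotients by nontrivial normal subgroups lie in \<open>F\<close>. If some
  nontrivial normal subgroup does not contain a given minimal normal subgroup \<open>N\<close>, the two intersect
  trivially and \<open>G\<close> is a subdirect product of two groups of \<open>F\<close>. What remains is the case in which \<open>N\<close> lies in every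
  nontrivial normal subgroup.
\<close>

lemma formation_by_monolithic_groups:
  fixes G :: "nat monoid"
  assumes F: "formation F" "F \<noteq> {}"
    and closed: "\<And>(G :: nat monoid) (H :: nat monoid) h. P G \<Longrightarrow> group_epi G H h \<Longrightarrow> P H"
    and monolith: "\<And>(G :: nat monoid) N. group G \<Longrightarrow> finite (carrier G) \<Longrightarrow> P G \<Longrightarrow> minimal_normal N G \<Longrightarrow>
      (\<And>M. M \<lhd> G \<Longrightarrow> M \<noteq> {\<one>\<^bsub>G\<^esub>} \<Longrightarrow> N \<subseteq> M) \<Longrightarrow> G Mod N \<in>\<^sub>c F \<Longrightarrow> G \<in>\<^sub>c F"
    and G: "group G" "finite (carrier G)" "P G"
  shows "G \<in> F"
proof -
  have "G \<in>\<^sub>c F"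
    using G
  proof (induction "order G" arbitrary: G rule: less_induct)
    case less
    interpret group G by fact
    show ?case
    proof (cases "carrier G = {\<one>\<^bsub>G\<^esub>}")
      case True
      then show ?thesis using formation_trivial[OF F is_group] by blast
    next
      case False
      have quot: "G Mod M \<in>\<^sub>c F" if M: "M \<lhd> G" "M \<noteq> {\<one>\<^bsub>G\<^esub>}" for M
      proof -
        interpret q: group_epi G "G Mod M" "\<lambda>x. M #>\<^bsub>G\<^esub> x" using M(1) by (rule quotient_epi)
        note fin = finite_quotient[OF less.prems(2), of M]
        note c = nat_copy[OF q.H.is_group fin]
        have sub: "subgroup M G" using M(1) by (rule normal_imp_subgroup)
        have "finite M" using less.prems(2) subgroup.subset[OF sub] finite_subset by blast
        then have "card M \<noteq> 0" "card M \<noteq> 1"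
          using subgroup.one_closed[OF sub] M(2) by (auto simp: card_1_singleton_iff)
        then have "card M > 1" by simp
        moreover have "order (G Mod M) > 0" using q.H.order_gt_0_iff_finite fin by blast
        ultimately have "order (G Mod M) < order G"
          using order_quotient[OF M(1)] by (metis less_1_mult nat_mult_1_right mult_less_mono2)
        then have "order (nat_copy (G Mod M)) < order G"
          using iso_same_card[OF c(2)] by (simp add: order_def)
        moreover have "finite (carrier (nat_copy (G Mod M)))" using fin iso_finite[OF c(2)] by simp
        moreover have "P (nat_copy (G Mod M))"
        proof -
          obtain k where "group_epi (G Mod M) (nat_copy (G Mod M)) k" using iso_epi[OF q.H.is_group c] .
          from closed[OF less.prems(3) q.comp[OF this]] show ?thesis .
        qed
        ultimately have "nat_copy (G Mod M) \<in>\<^sub>c F" using less.hyps c(1) by blast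
        then show ?thesis using belongs_iso[OF q.H.is_group c(2)] by blast
      qed
      obtain N where N: "minimal_normal N G"
        using exists_minimal_normal[OF less.prems(2) normal_self False] .
      have N': "N \<lhd> G" "N \<noteq> {\<one>\<^bsub>G\<^esub>}" using N by (auto simp: minimal_normal_def)
      show ?thesis
      proof (cases "\<forall>M. M \<lhd> G \<and> M \<noteq> {\<one>\<^bsub>G\<^esub>} \<longrightarrow> N \<subseteq> M")
        case True
        then show ?thesis using monolith[OF less.prems N _ quot[OF N']] by blast
      next
        case False
        then obtain M where M: "M \<lhd> G" "M \<noteq> {\<one>\<^bsub>G\<^esub>}" "\<not> N \<subseteq> M" by blast
        have "N \<inter> M \<lhd> G" using N'(1) M(1) by (rule normal_subgroup_intersect)
        then have "N \<inter> M = {\<one>\<^bsub>G\<^esub>}" using N M(3) unfolding minimal_normal_def by blast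
        then show ?thesis
          using formation_subdirect[OF F(1) is_group less.prems(2) N'(1) M(1)] quot[OF N'] quot[OF M(1,2)] by blast
      qed
    qed
  qed
  then show ?thesis using belongs_iff_mem[OF formation_group_class[OF F(1)] G(1)] by blast
qed

lemma (in group) chief_factor_of_monolithic:
  assumes N: "minimal_normal N G" "\<And>M. M \<lhd> G \<Longrightarrow> M \<noteq> {\<one>} \<Longrightarrow> N \<subseteq> M"
    and "chief_factor G A K"
  shows "N \<subseteq> K \<or> A = N \<and> K = {\<one>}"
proof (cases "K = {\<one>}")
  case True
  then have "minimal_normal A G" using assms(3) minimal_normal_iff_chief_factor by simp
  then have "A = N"
    using N unfolding minimal_normal_def by blast
  then show ?thesis using True by blast
next
  case False
  then show ?thesis using N(2) assms(3) unfolding chief_factor_def by blast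
qed

lemma (in group) identity_epi: "group_epi G G (\<lambda>x. x)" "kernel G G (\<lambda>x. x) = {\<one>}"
proof -
  show "group_epi G G (\<lambda>x. x)" by (intro group_epiI is_group) (simp add: epi_def hom_def)
  show "kernel G G (\<lambda>x. x) = {\<one>}" by (auto simp: kernel_def)
qed

lemma trivial_quotient_iso:
  assumes "group G" shows "G Mod {\<one>\<^bsub>G\<^esub>} \<cong> G"
  using group.trivial_factor_iso[OF assms] by (rule is_isoI)

lemma factor_trivial_iso:
  assumes "group G" "subgroup N G"
  shows "factor G N {\<one>\<^bsub>G\<^esub>} \<cong> G\<lparr>carrier := N\<rparr>"
  using trivial_quotient_iso[OF group.subgroup_imp_group[OF assms]] by (simp add: factor_def)

lemma (in group) Com_factor_one:
  assumes "finite (carrier G)" "M \<lhd> G"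
  shows "Com (factor G M {\<one>}) = Com (G\<lparr>carrier := M\<rparr>)"
proof (rule Com_iso)
  have sM: "subgroup M G" using assms(2) by (rule normal_imp_subgroup)
  have "{\<one>} \<subseteq> M" using subgroup.one_closed[OF sM] by simp
  note f = factor_group[OF assms(2) one_is_normal this]
  show "group (factor G M {\<one>})" "finite (carrier (factor G M {\<one>}))" using f assms(1) by auto
  show "group (G\<lparr>carrier := M\<rparr>)" using sM by (rule subgroup_imp_group)
  show "factor G M {\<one>} \<cong> G\<lparr>carrier := M\<rparr>" using factor_trivial_iso[OF is_group sM] .
qed

lemma (in group) Soc_of_monolithic:
  assumes "minimal_normal N G" "\<And>M. M \<lhd> G \<Longrightarrow> M \<noteq> {\<one>} \<Longrightarrow> N \<subseteq> M"
  shows "Soc G = N" "monolithic G"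
proof -
  have u: "M = N" if "minimal_normal M G" for M
    using that assms unfolding minimal_normal_def by blast
  then have "{M. minimal_normal M G} = {N}" using assms(1) by blast
  moreover have "generate G N = N"
    using assms(1) normal_imp_subgroup generateI[of N N] unfolding minimal_normal_def by blast
  ultimately show "Soc G = N" by (simp add: Soc_def)
  show "monolithic G" unfolding monolithic_def using assms(1) u by blast
qed

text \<open>
  A nontrivial centralizer contains \<open>N\<close>, so \<open>N\<close> is abelian, and so are its composition factors.
\<close>

lemma (in group) centralizer_nonabelian_monolith:
  assumes "finite (carrier G)" "minimal_normal N G" "\<And>M. M \<lhd> G \<Longrightarrow> M \<noteq> {\<one>} \<Longrightarrow> N \<subseteq> M"
    and "S \<in> Com (G\<lparr>carrier := N\<rparr>)" "\<not> comm_group S"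
  shows "centralizer G N {\<one>} = {\<one>}"
proof (rule ccontr)
  assume "centralizer G N {\<one>} \<noteq> {\<one>}"
  have N: "N \<lhd> G" using assms(2) by (simp add: minimal_normal_def)
  have sN: "subgroup N G" using N by (rule normal_imp_subgroup)
  have "centralizer G N {\<one>} \<lhd> G" using N one_is_normal by (rule centralizer_normal)
  then have sub: "N \<subseteq> centralizer G N {\<one>}" using assms(3) \<open>centralizer G N {\<one>} \<noteq> {\<one>}\<close> by blast
  interpret N: group "G\<lparr>carrier := N\<rparr>" using sN by (rule subgroup_imp_group)
  have "x \<otimes> y = y \<otimes> x" if "x \<in> N" "y \<in> N" for x y
    using group_epi.mem_centralizer_iff[OF identity_epi(1) subgroup.subset[OF sN], of x] sub that
    unfolding identity_epi(2) by blast
  then have "comm_group (G\<lparr>carrier := N\<rparr>)" by (intro N.group_comm_groupI) simp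
  moreover have "finite (carrier (G\<lparr>carrier := N\<rparr>))"
    using assms(1) subgroup.subset[OF sN] finite_subset by auto
  ultimately show False using Com_comm_group assms(4,5) by blast
qed

text \<open>
  A nontrivial normal subgroup \<open>M\<close> contains \<open>N\<close>, so it shares the composition factors of \<open>N\<close> and is not among the generators.
\<close>

lemma (in group) small_centralizer_monolith:
  assumes "finite (carrier G)" "minimal_normal N G" "\<And>M. M \<lhd> G \<Longrightarrow> M \<noteq> {\<one>} \<Longrightarrow> N \<subseteq> M"
  shows "small_centralizer G N {\<one>} = {\<one>}"
proof -
  have N: "N \<lhd> G" "N \<noteq> {\<one>}" using assms(2) by (auto simp: minimal_normal_def)
  have "M \<subseteq> {\<one>}" if M: "M \<lhd> G" "Com (factor G (M <#> {\<one>}) {\<one>}) \<inter> Com (factor G N {\<one>}) = {}" for M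
  proof (rule ccontr)
    assume "\<not> M \<subseteq> {\<one>}"
    then have "N \<subseteq> M" using assms(3)[OF M(1)] by blast
    have sM: "subgroup M G" and sN: "subgroup N G" using M(1) N(1) normal_imp_subgroup by auto
    interpret M: group "G\<lparr>carrier := M\<rparr>" using sM by (rule subgroup_imp_group)
    interpret N: group "G\<lparr>carrier := N\<rparr>" using sN by (rule subgroup_imp_group)
    have fin: "finite (carrier (G\<lparr>carrier := M\<rparr>))" "finite (carrier (G\<lparr>carrier := N\<rparr>))"
      using assms(1) subgroup.subset[OF sM] subgroup.subset[OF sN] finite_subset by auto
    have "N \<lhd> G\<lparr>carrier := M\<rparr>" using factor_group(1)[OF M(1) N(1) \<open>N \<subseteq> M\<close>] .
    then have "Com (G\<lparr>carrier := N\<rparr>) \<subseteq> Com (G\<lparr>carrier := M\<rparr>)"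
      using M.Com_subnormal_subset[OF fin(1) M.normal_subnormal] by simp
    moreover have "Com (G\<lparr>carrier := N\<rparr>) \<noteq> {}" using N.Com_nonempty[OF fin(2)] N(2) by simp
    moreover have "M <#> {\<one>} = M" using subgroup.subset[OF sM] by (auto simp: set_mult_def subset_iff)
    ultimately show False using M(2) Com_factor_one[OF assms(1) M(1)] Com_factor_one[OF assms(1) N(1)] by auto
  qed
  then have U: "\<Union>{M. M \<lhd> G \<and> Com (factor G (M <#> {\<one>}) {\<one>}) \<inter> Com (factor G N {\<one>}) = {}} \<subseteq> {\<one>}" by blast
  show ?thesis
  proof
    show "small_centralizer G N {\<one>} \<subseteq> {\<one>}"
      unfolding small_centralizer_def using generate_subgroup_incl[OF U triv_subgroup] .
    show "{\<one>} \<subseteq> small_centralizer G N {\<one>}"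
      unfolding small_centralizer_def using generate.one by auto
  qed
qed

section \<open>Local formations and composition satellites\<close>

text \<open>
  Any nontrivial element generates the group; the kernel of the resulting map from the integers
  depends on the order only, which identifies groups of the same prime order.
\<close>

lemma prime_order_int_pow_epi:
  assumes "group G" "prime (order G)"
  shows "\<exists>h. group_epi integer_group G h \<and> kernel integer_group G h = {n. int (order G) dvd n}"
proof -
  interpret group G by fact
  have fin: "finite (carrier G)" using order_gt_0_iff_finite prime_gt_0_nat[OF assms(2)] by simp
  have "carrier G \<noteq> {\<one>\<^bsub>G\<^esub>}" using assms(2) by (auto simp: order_def)
  then obtain x where x: "x \<in> carrier G" "x \<noteq> \<one>\<^bsub>G\<^esub>" using one_closed by blast
  have hom: "(\<lambda>n::int. x [^]\<^bsub>G\<^esub> n) \<in> hom integer_group G"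
    by (rule homI) (use x(1) in \<open>auto simp: int_pow_mult\<close>)
  interpret h: group_hom integer_group G "\<lambda>n::int. x [^]\<^bsub>G\<^esub> n"
    using hom is_group by (simp add: group_hom_def group_hom_axioms_def)
  let ?I = "(\<lambda>n::int. x [^]\<^bsub>G\<^esub> n) ` carrier integer_group"
  have sub: "subgroup ?I G" by (rule h.img_is_subgroup)
  have xI: "x \<in> ?I" by (rule image_eqI[of _ _ 1]) (simp_all add: x(1))
  have "card ?I \<noteq> 1"
  proof
    assume "card ?I = 1"
    then obtain y where "?I = {y}" by (rule card_1_singletonE)
    then have "x = y" "\<one>\<^bsub>G\<^esub> = y" using xI subgroup.one_closed[OF sub] by (simp_all only: singleton_iff)
    then show False using x(2) by simp
  qed
  moreover have "card ?I dvd order G" using lagrange[OF sub] by (metis dvd_triv_right)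
  ultimately have "card ?I = card (carrier G)" using assms(2) unfolding prime_nat_iff order_def by blast
  then have I: "?I = carrier G" using card_subset_eq[OF fin subgroup.subset[OF sub]] by blast
  have "ord x dvd order G" using x(1) by (rule ord_dvd_group_order)
  moreover have "ord x \<noteq> 1" using ord_eq_1[OF x(1)] x(2) by simp
  ultimately have "ord x = order G" using assms(2) unfolding prime_nat_iff by blast
  then have "kernel integer_group G (\<lambda>n::int. x [^]\<^bsub>G\<^esub> n) = {n. int (order G) dvd n}"
    using int_pow_eq_id[OF x(1)] by (simp add: kernel_def)
  moreover have "group_epi integer_group G (\<lambda>n::int. x [^]\<^bsub>G\<^esub> n)"
    by (intro group_epiI group_integer_group is_group) (use hom I in \<open>simp add: epi_def\<close>)
  ultimately show ?thesis by blast
qed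

lemma prime_order_iso:
  assumes "group G" "group H" "prime (order G)" "order H = order G"
  shows "G \<cong> H"
proof -
  obtain h where h: "group_epi integer_group G h" "kernel integer_group G h = {n. int (order G) dvd n}"
    using prime_order_int_pow_epi[OF assms(1,3)] by blast
  have "prime (order H)" using assms(3,4) by simp
  then obtain k where k: "group_epi integer_group H k" "kernel integer_group H k = {n. int (order H) dvd n}"
    using prime_order_int_pow_epi[OF assms(2)] by blast
  have "kernel integer_group G h = kernel integer_group H k" unfolding h(2) k(2) assms(4) ..
  then show ?thesis using iso_of_equal_kernel[OF h(1) k(1)] by blast
qed

lemma (in group) chief_factor_Com_eq:
  assumes "finite (carrier G)" "chief_factor G A K" "P \<in> Com (factor G A K)"
  shows "Com (factor G A K) = Com P"
proof -
  have P: "P \<in> \<JJ>" using assms(3) by (simp add: Com_def)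
  have "S \<in> Com (factor G A K)" if "S \<in> \<JJ>" "S \<cong> P" for S
    using that assms(3) iso_trans[OF that(2)] unfolding Com_def by blast
  then show ?thesis
    using chief_factor_Com_iso[OF assms(1,2) _ assms(3)] unfolding Com_simple[OF P] by (auto simp: Com_def)
qed

lemma Com_eq_simple_iff:
  assumes "P \<in> \<JJ>" "S \<in> \<JJ>" shows "Com S = Com P \<longleftrightarrow> S \<cong> P"
proof
  assume "Com S = Com P"
  then show "S \<cong> P" using assms Com_simple iso_refl[of S] by blast
next
  assume "S \<cong> P"
  then show "Com S = Com P" using Com_iso simple_groupsD assms by blast
qed

lemma compl_value_eq:
  assumes "composition_satellite L f" "A \<in> Ecl (compl_class L)" "nonidentity A"
  shows "compl_value L f = f A"
  unfolding compl_value_def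
proof (rule the_equality)
  show "\<forall>G\<in>Ecl (compl_class L). nonidentity G \<longrightarrow> f G = f A"
    using assms unfolding composition_satellite_def by blast
  show "B = f A" if "\<forall>G\<in>Ecl (compl_class L). nonidentity G \<longrightarrow> f G = B" for B
    using that assms(2,3) by blast
qed

lemma simple_class_compl: "simple_class X \<Longrightarrow> simple_class (compl_class X)"
  unfolding simple_class_def group_class_def compl_class_def
proof (intro conjI ballI allI impI; (elim conjE)?)
  assume X: "\<forall>G\<in>X. \<forall>H. group H \<and> G \<cong> H \<longrightarrow> H \<in> X"
  fix S T :: "nat monoid" assume S: "S \<in> \<JJ> - X" and T: "group T" "S \<cong> T"
  have "simple_group T"
    using simple_group.iso_simple[OF _ T(1)] T(2) simple_groupsD(3) S unfolding is_iso_def by blast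
  then have "T \<in> \<JJ>" using S T iso_finite[OF T(2)] by (simp add: simple_groups_def finite_groups_def)
  moreover have "T \<notin> X" using X S T(2) group.iso_sym[OF simple_groupsD(1)] simple_groupsD(1) by blast
  ultimately show "T \<in> \<JJ> - X" by blast
qed (auto simp: simple_groups_def)

lemma simple_class_abelian_part:
  assumes "simple_class X" shows "simple_class (abelian_part X)"
  unfolding simple_class_def group_class_def
proof (intro conjI ballI allI impI; (elim conjE)?)
  fix S T :: "nat monoid" assume S: "S \<in> abelian_part X" and T: "group T" "S \<cong> T"
  have S': "S \<in> X" "comm_group S" using S by (auto simp: abelian_part_def)
  have "comm_group T" using comm_group.iso_imp_comm_group[OF S'(2) T(2)] T(1) group.is_monoid by blast
  moreover have "T \<in> X" using assms S'(1) T unfolding simple_class_def group_class_def by blast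
  ultimately show "T \<in> abelian_part X" by (simp add: abelian_part_def)
qed (use assms in \<open>auto simp: simple_class_def group_class_def abelian_part_def\<close>)

lemma simple_class_iso:
  assumes "simple_class M" "S \<in> \<JJ>" "T \<in> \<JJ>" "S \<cong> T" shows "S \<in> M \<longleftrightarrow> T \<in> M"
  using assms group.iso_sym[OF simple_groupsD(1)[OF assms(2)] assms(4)] simple_groupsD(1)
  unfolding simple_class_def group_class_def by blast

lemma simple_class_Com_eq:
  assumes "simple_class M" "P \<in> M" "S \<in> \<JJ>" "Com S = Com P" shows "S \<in> M"
proof -
  have "P \<in> \<JJ>" using assms(1,2) by (auto simp: simple_class_def)
  then show ?thesis using assms simple_class_iso Com_eq_simple_iff by blast
qed

text \<open>
  This is how the hypothesis on the characteristic enters: it makes the orders of the abelian groups in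
  \<open>X\<close> primes, and places them in the domain of a local function.
\<close>

lemma abelian_part_order:
  assumes "simple_class X" "char_primes X = primes_of_class X" "P \<in> abelian_part X"
  shows "P \<in> \<JJ>" "prime (order P)" "order P \<in> primes_of_class X"
proof -
  show P: "P \<in> \<JJ>" using assms(1,3) by (auto simp: simple_class_def abelian_part_def)
  have "order P \<in> char_primes X"
    unfolding char_primes_def using assms(3) simple_groupsD(3)[OF P] by (auto simp: abelian_part_def)
  then show "order P \<in> primes_of_class X" using assms(2) by simp
  then show "prime (order P)" by (auto simp: primes_of_class_def primes_of_def)
qed

lemma (in group) chief_factor_obtain:
  assumes "finite (carrier G)" "chief_factor G A K"
  obtains S where "S \<in> Com (factor G A K)" "S \<in> \<JJ>" "Com (factor G A K) = Com S"
proof -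
  note cf = chief_factor_group[OF assms(2)]
  have "Com (factor G A K) \<noteq> {}"
    using group.Com_nonempty[OF cf(4)] factor_group(3)[OF cf(1-3) assms(1)] cf(5) by blast
  then obtain S where S: "S \<in> Com (factor G A K)" by blast
  moreover have "S \<in> \<JJ>" using S by (simp add: Com_def)
  ultimately show thesis using chief_factor_Com_eq[OF assms S] by (intro that)
qed

lemma (in group) chief_factor_primes:
  assumes "finite (carrier G)" "chief_factor G A K" "S \<in> Com (factor G A K)" "prime (order S)"
  shows "primes_of (factor G A K) = {order S}"
proof -
  note cf = chief_factor_group[OF assms(2)]
  note fin = factor_group(3)[OF cf(1-3) assms(1)]
  have "p = order S" if p: "prime p" "p dvd order (factor G A K)" for p
  proof -
    obtain T where T: "T \<in> Com (factor G A K)" "p dvd order T"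
      using group.Com_prime_divisor[OF cf(4) fin p] by blast
    then have "T \<cong> S" using chief_factor_Com_iso[OF assms(1,2) _ assms(3)] by blast
    then have "order T = order S" using iso_same_card by (auto simp: order_def)
    then show ?thesis using T(2) p(1) assms(4) by (simp add: primes_dvd_imp_eq)
  qed
  moreover have "order S dvd order (factor G A K)"
    using group.Com_order_dvd[OF cf(4) fin assms(3)] .
  ultimately show ?thesis using assms(4) unfolding primes_of_def by blast
qed

text \<open>
  Since a chief factor has one composition factor up to isomorphism, it belongs to one of the classes
  \<open>Ecl M\<close> and \<open>Ecl (compl_class M)\<close>.
\<close>

lemma (in group) chief_factor_belongs_Ecl_iff:
  assumes "finite (carrier G)" "chief_factor G A K" "S \<in> Com (factor G A K)" "simple_class M"
  shows "factor G A K \<in>\<^sub>c Ecl M \<longleftrightarrow> S \<in> M"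
proof -
  note cf = chief_factor_group[OF assms(2)]
  note fin = factor_group(3)[OF cf(1-3) assms(1)]
  have "T \<in> M" if "S \<in> M" "T \<in> Com (factor G A K)" for T
    using simple_class_iso[OF assms(4), of S T] chief_factor_Com_iso[OF assms(1-3) that(2)] that assms(3)
    by (simp add: Com_def)
  then show ?thesis using belongs_Ecl_iff[OF cf(4) fin] assms(3) by blast
qed

lemma (in group) quotient_one_belongs_iff: "G Mod {\<one>} \<in>\<^sub>c F \<longleftrightarrow> G \<in>\<^sub>c F"
  using belongs_iso[OF normal.factorgroup_is_group[OF one_is_normal] trivial_quotient_iso[OF is_group]] .

lemma (in group) quotient_one_monolith_condition_iff:
  assumes "finite (carrier G)"
  shows "monolith_condition X f (G Mod {\<one>}) \<longleftrightarrow> monolith_condition X f G"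
  using monolith_condition_iso[OF normal.factorgroup_is_group[OF one_is_normal] is_group
      finite_quotient[OF assms] trivial_quotient_iso[OF is_group]] .

text \<open>
  The chief factors above \<open>N\<close> are tested in the quotient \<open>Q\<close>.
\<close>

lemma mem_CF_of_monolith:
  assumes "composition_satellite L f" "Q \<in> CF L f" "finite (carrier G)"
    and "group_epi G Q k" "kernel G Q k = N"
    and min: "minimal_normal N G" and mono: "\<And>M. M \<lhd> G \<Longrightarrow> M \<noteq> {\<one>\<^bsub>G\<^esub>} \<Longrightarrow> N \<subseteq> M"
    and "f_central L f G N {\<one>\<^bsub>G\<^esub>}"
  shows "G \<in> CF L f"
proof -
  interpret k: group_epi G Q k by fact
  have "f_central L f G A K" if c: "chief_factor G A K" for A K
    using k.G.chief_factor_of_monolithic[OF min mono c]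
  proof
    assume "N \<subseteq> K"
    then have ker: "kernel G Q k \<subseteq> K" using assms(5) by simp
    have "f_central L f Q (k ` A) (k ` K)"
      using assms(2) k.chief_factor_image[OF c ker] by (simp add: CF_def)
    then show ?thesis using k.f_central_iff[OF assms(1,3) c ker] by blast
  next
    assume "A = N \<and> K = {\<one>\<^bsub>G\<^esub>}"
    then show ?thesis using assms(8) by simp
  qed
  then show ?thesis using assms(3) k.G.is_group by (simp add: CF_def finite_groups_def)
qed

text \<open>
  The chief factors above \<open>N\<close> and the quotients by nontrivial normal subgroups are tested in \<open>Q\<close>.
\<close>

lemma mem_LF_of_monolith:
  assumes "Q \<in> LF X f" "finite (carrier G)" "group_epi G Q k" "kernel G Q k = N"
    and min: "minimal_normal N G" and mono: "\<And>M. M \<lhd> G \<Longrightarrow> M \<noteq> {\<one>\<^bsub>G\<^esub>} \<Longrightarrow> N \<subseteq> M"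
    and "chief_condition X f G N {\<one>\<^bsub>G\<^esub>}" "monolith_condition X f G"
  shows "G \<in> LF X f"
proof -
  interpret k: group_epi G Q k by fact
  have "chief_condition X f G A K" if c: "chief_factor G A K" for A K
    using k.G.chief_factor_of_monolithic[OF min mono c]
  proof
    assume "N \<subseteq> K"
    then have ker: "kernel G Q k \<subseteq> K" using assms(4) by simp
    have "chief_condition X f Q (k ` A) (k ` K)"
      using assms(1) k.chief_factor_image[OF c ker] by (simp add: mem_LF_iff)
    then show ?thesis using k.chief_condition_iff[OF assms(2) c ker] by blast
  next
    assume "A = N \<and> K = {\<one>\<^bsub>G\<^esub>}"
    then show ?thesis using assms(7) by simp
  qed
  moreover have "monolith_condition X f (G Mod M)" if M: "M \<lhd> G" for M
  proof (cases "M = {\<one>\<^bsub>G\<^esub>}")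
    case True
    then show ?thesis using k.G.quotient_one_monolith_condition_iff[OF assms(2)] assms(8) by simp
  next
    case False
    then have ker: "kernel G Q k \<subseteq> M" using mono[OF M] assms(4) by simp
    have M': "k ` M \<lhd> Q" using M by (rule k.normal_image)
    then have "monolith_condition X f (Q Mod (k ` M))" using assms(1) by (simp add: mem_LF_iff)
    then show ?thesis
      using monolith_condition_iso[OF normal.factorgroup_is_group[OF M] normal.factorgroup_is_group[OF M']
          finite_quotient[OF assms(2)] k.quotient_image_iso[OF M ker]] by blast
  qed
  ultimately show ?thesis using assms(2) k.G.is_group by (simp add: mem_LF_iff finite_groups_def)
qed

text \<open>
  The satellite takes the value \<open>f p\<close> at groups whose composition factors are a single abelian group of
  order \<open>p\<close> in \<open>X\<close>, and the value \<open>F\<close> at all other groups.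
\<close>

lemma local_formation_has_composition_satellite:
  assumes "F \<noteq> {}" "simple_class X" "char_primes X = primes_of_class X"
    and "simple_class L" "abelian_part L = abelian_part X" "local_formation X F"
  shows "has_composition_satellite L F"
proof -
  obtain f where form: "formation F" and f: "local_function X f" "F = LF X f"
    using assms(6) by (auto simp: local_formation_def)
  \<comment> \<open>The chosen \<open>P\<close> is determined up to isomorphism, so its order is determined.\<close>
  define h where "h A = (if \<exists>P\<in>abelian_part X. Com A = Com P
      then f (Inl (order (SOME P. P \<in> abelian_part X \<and> Com A = Com P))) else F)" for A :: "nat monoid"
  note ab = abelian_part_order[OF assms(2,3)]
  note cls = simple_class_compl[OF assms(4)] simple_class_abelian_part[OF assms(2)]
  have XL: "abelian_part X \<subseteq> L" using assms(5) by (auto simp: abelian_part_def)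
  have h_abelian: "h A = f (Inl (order P))" if P: "P \<in> abelian_part X" "Com A = Com P" for A P
  proof -
    define P' where "P' = (SOME P. P \<in> abelian_part X \<and> Com A = Com P)"
    have P': "P' \<in> abelian_part X \<and> Com A = Com P'"
      unfolding P'_def by (rule someI[of _ P]) (use P in simp)
    then have "P' \<cong> P" using Com_eq_simple_iff ab(1) P by blast
    then have "order P' = order P" using iso_same_card by (auto simp: order_def)
    moreover have "h A = f (Inl (order P'))" unfolding h_def P'_def using P by auto
    ultimately show ?thesis by simp
  qed
  have h_simple: "h S = F" if "S \<in> \<JJ>" "S \<notin> abelian_part X" for S
    unfolding h_def using simple_class_Com_eq[OF cls(2)] that by auto
  have h_compl: "h A = F" if A: "A \<in> Ecl (compl_class L)" for A
  proof -
    have "Com A \<noteq> Com P" if P: "P \<in> abelian_part X" for P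
    proof -
      have "P \<in> Com P" using Com_simple[OF ab(1)[OF P]] ab(1)[OF P] by simp
      moreover have "P \<in> L" using P XL by blast
      ultimately show ?thesis using A by (auto simp: Ecl_def compl_class_def)
    qed
    then show ?thesis unfolding h_def by auto
  qed
  have sat: "composition_satellite L h"
    unfolding composition_satellite_def
  proof (intro conjI ballI impI)
    fix A :: "nat monoid"
    show "formation (h A)"
    proof (cases "\<exists>P\<in>abelian_part X. Com A = Com P")
      case True
      then obtain P where P: "P \<in> abelian_part X" "Com A = Com P" by blast
      then show ?thesis using h_abelian[OF P] f(1) ab(3)[OF P(1)] by (auto simp: local_function_def)
    next
      case False
      then show ?thesis using form by (simp add: h_def)
    qed
  qed (simp_all add: h_compl, simp add: h_def)
  have h_copy: "h (nat_copy A) = h B" if "group A" "finite (carrier A)" "carrier A \<noteq> {\<one>\<^bsub>A\<^esub>}" "Com A = Com B"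
    for A :: "nat set monoid" and B
    using nat_copy_nonidentity(3)[OF that(1-3)] that(4) by (simp add: h_def)
  have compl_F: "compl_value L h = F"
    if A: "group A" "finite (carrier A)" "carrier A \<noteq> {\<one>\<^bsub>A\<^esub>}" "A \<in>\<^sub>c Ecl (compl_class L)"
    for A :: "nat set monoid"
  proof -
    note c = nat_copy_nonidentity[OF A(1-3)]
    have "nat_copy A \<in> Ecl (compl_class L)"
      using c A(4) belongs_Ecl_iff[OF A(1,2)] by (simp add: Ecl_def)
    then show ?thesis using compl_value_eq[OF sat _ c(2)] h_compl by simp
  qed
  have "F \<subseteq> CF L h"
  proof
    fix G assume G: "G \<in> F"
    then have G': "G \<in> LF X f" "group G" "finite (carrier G)" using f(2) by (auto simp: mem_LF_iff finite_groups_def)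
    interpret group G by fact
    have GF: "G \<in>\<^sub>c F" using belongs_iff_mem[OF formation_group_class[OF form] is_group] G by simp
    have quot: "G Mod N \<in>\<^sub>c F" if "N \<lhd> G" for N
      using formation_epi[OF form G'(3) GF quotient_epi(1)[OF that]] .
    have "f_central L h G A K" if c: "chief_factor G A K" for A K
    proof -
      note cf = chief_factor_group[OF c]
      note fin = factor_group(3)[OF cf(1-3) G'(3)]
      obtain S where S: "S \<in> Com (factor G A K)" "S \<in> \<JJ>" "Com (factor G A K) = Com S"
        using chief_factor_obtain[OF G'(3) c] .
      note Ecl_iff = chief_factor_belongs_Ecl_iff[OF G'(3) c S(1)]
      have cop: "h (nat_copy (factor G A K)) = h S" using h_copy[OF cf(4) fin cf(5) S(3)] .
      consider "S \<in> abelian_part X" | "S \<in> L" "S \<notin> abelian_part X" | "S \<notin> L" by blast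
      then show ?thesis
      proof cases
        case 1
        then have "factor G A K \<in>\<^sub>c Ecl X" using Ecl_iff[OF assms(2)] by (simp add: abelian_part_def)
        moreover have "order S \<in> primes_of (factor G A K)"
          using chief_factor_primes[OF G'(3) c S(1) ab(2)[OF 1]] by simp
        moreover have "chief_condition X f G A K" using G'(1) c by (simp add: mem_LF_iff)
        ultimately have "G Mod centralizer G A K \<in>\<^sub>c f (Inl (order S))" by (simp add: chief_condition_def)
        then show ?thesis
          unfolding f_central_def cop h_abelian[OF 1 refl] using Ecl_iff[OF assms(4)] 1 XL by blast
      next
        case 2
        have "G Mod centralizer G A K \<in>\<^sub>c F" using centralizer_normal[OF cf(1,2)] by (rule quot)
        then show ?thesis
          unfolding f_central_def cop h_simple[OF S(2) 2(2)] using Ecl_iff[OF assms(4)] 2(1) by blast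
      next
        case 3
        then have E: "factor G A K \<in>\<^sub>c Ecl (compl_class L)"
          using Ecl_iff[OF cls(1)] S(2) by (simp add: compl_class_def)
        have "{\<one>\<^bsub>G\<^esub>} \<subseteq> K" using subgroup.one_closed[OF normal_imp_subgroup[OF cf(2)]] by simp
        then have "small_centralizer G A K \<lhd> G"
          using group_epi.small_centralizer_image(1)[OF identity_epi(1) G'(3) cf(1-3)]
          unfolding identity_epi(2) by blast
        then have "G Mod small_centralizer G A K \<in>\<^sub>c F" by (rule quot)
        then show ?thesis unfolding f_central_def using E compl_F[OF cf(4) fin cf(5) E] by blast
      qed
    qed
    then show "G \<in> CF L h" using G'(2,3) by (simp add: CF_def finite_groups_def)
  qed
  moreover have "CF L h \<subseteq> F"
  proof
    fix G assume G: "G \<in> CF L h"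
    then have G': "group G" "finite (carrier G)" by (auto simp: CF_def finite_groups_def)
    show "G \<in> F"
    proof (rule formation_by_monolithic_groups[OF form assms(1), where P = "\<lambda>G. G \<in> CF L h", OF _ _ G' G])
      show "H \<in> CF L h" if "G \<in> CF L h" "group_epi G H k" for G H :: "nat monoid" and k
        using CF_epi_closed[OF sat that] .
    next
      fix G :: "nat monoid" and N
      assume grp: "group G" and fin: "finite (carrier G)" and GCF: "G \<in> CF L h"
        and min: "minimal_normal N G" and mono: "\<And>M. M \<lhd> G \<Longrightarrow> M \<noteq> {\<one>\<^bsub>G\<^esub>} \<Longrightarrow> N \<subseteq> M"
        and quot: "G Mod N \<in>\<^sub>c F"
      interpret group G by fact
      let ?Q = "factor G N {\<one>\<^bsub>G\<^esub>}"
      have c: "chief_factor G N {\<one>\<^bsub>G\<^esub>}" using min minimal_normal_iff_chief_factor by simp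
      note cf = chief_factor_group[OF c]
      note finQ = factor_group(3)[OF cf(1-3) fin]
      obtain S where S: "S \<in> Com ?Q" "S \<in> \<JJ>" "Com ?Q = Com S"
        using chief_factor_obtain[OF fin c] .
      note Ecl_iff = chief_factor_belongs_Ecl_iff[OF fin c S(1)]
      have SN: "S \<in> Com (G\<lparr>carrier := N\<rparr>)" using S(1) Com_factor_one[OF fin cf(1)] by simp
      have central: "f_central L h G N {\<one>\<^bsub>G\<^esub>}" using GCF c by (simp add: CF_def)
      show "G \<in>\<^sub>c F"
      proof (cases "S \<in> L")
        case False
        then have "\<not> ?Q \<in>\<^sub>c Ecl L" using Ecl_iff[OF assms(4)] by simp
        then have Q: "?Q \<in>\<^sub>c Ecl (compl_class L)" "G Mod small_centralizer G N {\<one>\<^bsub>G\<^esub>} \<in>\<^sub>c compl_value L h"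
          using central by (auto simp: f_central_def)
        then show ?thesis
          using small_centralizer_monolith[OF fin min mono] compl_F[OF cf(4) finQ cf(5) Q(1)]
          by (simp add: quotient_one_belongs_iff)
      next
        case True
        then have "\<not> ?Q \<in>\<^sub>c Ecl (compl_class L)" using Ecl_iff[OF cls(1)] by (simp add: compl_class_def)
        then have C: "G Mod centralizer G N {\<one>\<^bsub>G\<^esub>} \<in>\<^sub>c h S"
          using central h_copy[OF cf(4) finQ cf(5) S(3)] by (auto simp: f_central_def)
        show ?thesis
        proof (cases "S \<in> abelian_part X")
          case False
          then have "\<not> comm_group S" using True assms(5) by (auto simp: abelian_part_def)
          then have "centralizer G N {\<one>\<^bsub>G\<^esub>} = {\<one>\<^bsub>G\<^esub>}"
            using centralizer_nonabelian_monolith[OF fin min mono SN] by simp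
          then show ?thesis using C h_simple[OF S(2) False] by (simp add: quotient_one_belongs_iff)
        next
          case abelian: True
          obtain Q k where Q: "Q \<in> F" "group_epi G Q k" "kernel G Q k = N"
            using quotient_belongs_epi[OF formation_group_class[OF form] cf(1) quot] .
          have "chief_condition X f G N {\<one>\<^bsub>G\<^esub>}"
            using C chief_factor_primes[OF fin c S(1) ab(2)[OF abelian]]
            by (simp add: chief_condition_def h_abelian[OF abelian refl])
          moreover have "monolith_condition X f G"
          proof -
            have sN: "subgroup N G" using cf(1) by (rule normal_imp_subgroup)
            then have "finite (carrier (G\<lparr>carrier := N\<rparr>))"
              using fin subgroup.subset finite_subset by fastforce
            moreover have "S \<notin> compl_class X" using abelian by (simp add: abelian_part_def compl_class_def)
            ultimately have "\<not> G\<lparr>carrier := N\<rparr> \<in>\<^sub>c Ecl (compl_class X)"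
              using belongs_Ecl_iff[OF subgroup_imp_group[OF sN]] SN by blast
            then show ?thesis using Soc_of_monolithic(1)[OF min mono] by (simp add: monolith_condition_def)
          qed
          ultimately have "G \<in> F"
            using mem_LF_of_monolith[OF _ fin Q(2,3) min mono, of X f] Q(1) f(2) by blast
          then show ?thesis using belongs_iff_mem[OF formation_group_class[OF form] is_group] by blast
        qed
      qed
    qed
  qed
  ultimately show ?thesis using form sat by (auto simp: has_composition_satellite_def)
qed

text \<open>
  The local function takes at \<open>p\<close> the value of the satellite at a group of order \<open>p\<close>, and the value
  \<open>F\<close> at simple groups. Clause (ii) then says that certain quotients lie in \<open>F\<close>.
\<close>

lemma composition_satellite_imp_local_formation:
  assumes "F \<noteq> {}" "simple_class X" "char_primes X = primes_of_class X"
    and "simple_class L" "abelian_part L = abelian_part X" "has_composition_satellite L F"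
  shows "local_formation (abelian_part X) F"
proof -
  obtain f where form: "formation F" and sat: "composition_satellite L f" and F: "F = CF L f"
    using assms(6) by (auto simp: has_composition_satellite_def)
  let ?Y = "abelian_part X"
  note ab = abelian_part_order[OF assms(2,3)]
  note Y = simple_class_abelian_part[OF assms(2)]
  have YL: "?Y \<subseteq> L" using assms(5) by (auto simp: abelian_part_def)
  \<comment> \<open>Groups of the same prime order are isomorphic, so the choice does not affect the composition factors.\<close>
  define rep where "rep p = (SOME P. P \<in> ?Y \<and> order P = p)" for p
  define g :: "nat + nat monoid \<Rightarrow> grp_class" where "g = case_sum (\<lambda>p. f (rep p)) (\<lambda>S. F)"
  have rep: "rep (order P) \<in> ?Y" "rep (order P) \<cong> P" if P: "P \<in> ?Y" for P
  proof -
    have r: "rep (order P) \<in> ?Y \<and> order (rep (order P)) = order P"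
      unfolding rep_def by (rule someI[of _ P]) (use P in simp)
    then show "rep (order P) \<in> ?Y" by blast
    then show "rep (order P) \<cong> P"
      using prime_order_iso r ab(2) P simple_groupsD(1) ab(1) by metis
  qed
  have g_prime: "g (Inl (order P)) = f (nat_copy A)"
    if P: "P \<in> ?Y" and A: "group A" "finite (carrier A)" "carrier A \<noteq> {\<one>\<^bsub>A\<^esub>}" "Com A = Com P"
    for P and A :: "nat set monoid"
  proof -
    note R = simple_groupsD[OF ab(1)[OF rep(1)[OF P]]]
    have "Com (rep (order P)) = Com P"
      using Com_eq_simple_iff[OF ab(1)[OF P] ab(1)[OF rep(1)[OF P]]] rep(2)[OF P] by blast
    then show ?thesis
      using satellite_nat_copy_eq[OF sat A(1-3), of "rep (order P)"] A(4) R
      by (simp add: g_def finite_groups_def nonidentity_def)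
  qed
  have loc: "local_function ?Y g"
    unfolding local_function_def
  proof (intro conjI ballI impI)
    fix a assume "a \<in> primes_of_class ?Y <+> compl_class ?Y"
    then show "formation (g a)"
    proof (rule PlusE)
      fix p assume a: "a = Inl p" and "p \<in> primes_of_class ?Y"
      then obtain P where P: "P \<in> ?Y" "prime p" "p dvd order P"
        by (auto simp: primes_of_class_def primes_of_def)
      then have "p = order P" using ab(2) by (simp add: primes_dvd_imp_eq)
      then have "rep p \<in> ?Y" using rep(1) P(1) by blast
      then have "rep p \<in> finite_groups" using simple_groupsD[OF ab(1)] by (simp add: finite_groups_def)
      then show ?thesis using sat a by (simp add: composition_satellite_def g_def)
    qed (use form in \<open>simp add: g_def\<close>)
  qed (simp add: g_def)
  have "F \<subseteq> LF ?Y g"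
  proof
    fix G assume G: "G \<in> F"
    then have G': "G \<in> CF L f" "group G" "finite (carrier G)" using F by (auto simp: CF_def finite_groups_def)
    interpret group G by fact
    have GF: "G \<in>\<^sub>c F" using belongs_iff_mem[OF formation_group_class[OF form] is_group] G by simp
    have "chief_condition ?Y g G A K" if c: "chief_factor G A K" for A K
    proof -
      note cf = chief_factor_group[OF c]
      note fin = factor_group(3)[OF cf(1-3) G'(3)]
      obtain S where S: "S \<in> Com (factor G A K)" "S \<in> \<JJ>" "Com (factor G A K) = Com S"
        using chief_factor_obtain[OF G'(3) c] .
      note Ecl_iff = chief_factor_belongs_Ecl_iff[OF G'(3) c S(1)]
      have "G Mod centralizer G A K \<in>\<^sub>c g (Inl p)"
        if Q: "factor G A K \<in>\<^sub>c Ecl ?Y" and p: "p \<in> primes_of (factor G A K)" for p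
      proof -
        have SY: "S \<in> ?Y" using Ecl_iff[OF Y] Q by blast
        then have "\<not> factor G A K \<in>\<^sub>c Ecl (compl_class L)"
          using Ecl_iff[OF simple_class_compl[OF assms(4)]] YL by (auto simp: compl_class_def)
        moreover have "f_central L f G A K" using G'(1) c by (simp add: CF_def)
        ultimately have "G Mod centralizer G A K \<in>\<^sub>c f (nat_copy (factor G A K))"
          by (simp add: f_central_def)
        moreover have "p = order S" using chief_factor_primes[OF G'(3) c S(1) ab(2)[OF SY]] p by simp
        ultimately show ?thesis using g_prime[OF SY cf(4) fin cf(5) S(3)] by simp
      qed
      then show ?thesis by (simp add: chief_condition_def)
    qed
    moreover have "monolith_condition ?Y g (G Mod N)" if "N \<lhd> G" for N
      using formation_epi[OF form G'(3) GF quotient_epi(1)[OF that]]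
      by (simp add: monolith_condition_def g_def)
    ultimately show "G \<in> LF ?Y g" using G'(2,3) by (simp add: mem_LF_iff finite_groups_def)
  qed
  moreover have "LF ?Y g \<subseteq> F"
  proof
    fix G assume G: "G \<in> LF ?Y g"
    then have G': "group G" "finite (carrier G)" by (auto simp: mem_LF_iff finite_groups_def)
    show "G \<in> F"
    proof (rule formation_by_monolithic_groups[OF form assms(1), where P = "\<lambda>G. G \<in> LF ?Y g", OF _ _ G' G])
      show "H \<in> LF ?Y g" if "G \<in> LF ?Y g" "group_epi G H k" for G H :: "nat monoid" and k
        using LF_epi_closed[OF that] .
    next
      fix G :: "nat monoid" and N
      assume grp: "group G" and fin: "finite (carrier G)" and GLF: "G \<in> LF ?Y g"
        and min: "minimal_normal N G" and mono: "\<And>M. M \<lhd> G \<Longrightarrow> M \<noteq> {\<one>\<^bsub>G\<^esub>} \<Longrightarrow> N \<subseteq> M"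
        and quot: "G Mod N \<in>\<^sub>c F"
      interpret group G by fact
      let ?Q = "factor G N {\<one>\<^bsub>G\<^esub>}"
      have c: "chief_factor G N {\<one>\<^bsub>G\<^esub>}" using min minimal_normal_iff_chief_factor by simp
      note cf = chief_factor_group[OF c]
      note finQ = factor_group(3)[OF cf(1-3) fin]
      obtain S where S: "S \<in> Com ?Q" "S \<in> \<JJ>" "Com ?Q = Com S"
        using chief_factor_obtain[OF fin c] .
      note Ecl_iff = chief_factor_belongs_Ecl_iff[OF fin c S(1)]
      show "G \<in>\<^sub>c F"
      proof (cases "S \<in> ?Y")
        case False
        then have "?Q \<in>\<^sub>c Ecl (compl_class ?Y)"
          using Ecl_iff[OF simple_class_compl[OF Y]] S(2) by (simp add: compl_class_def)
        then have "G\<lparr>carrier := N\<rparr> \<in>\<^sub>c Ecl (compl_class ?Y)"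
          using belongs_iso[OF cf(4) factor_trivial_iso[OF is_group normal_imp_subgroup[OF cf(1)]]] by blast
        moreover have "S \<in> Com (G\<lparr>carrier := N\<rparr>)" using S(1) Com_factor_one[OF fin cf(1)] by simp
        moreover have "monolith_condition ?Y g (G Mod {\<one>\<^bsub>G\<^esub>})"
          using GLF one_is_normal unfolding mem_LF_iff by blast
        then have "monolith_condition ?Y g G" using quotient_one_monolith_condition_iff[OF fin] by blast
        ultimately have "G \<in>\<^sub>c g (Inr S)"
          using Soc_of_monolithic[OF min mono] by (simp add: monolith_condition_def)
        then show ?thesis by (simp add: g_def)
      next
        case True
        obtain Q k where Q: "Q \<in> F" "group_epi G Q k" "kernel G Q k = N"
          using quotient_belongs_epi[OF formation_group_class[OF form] cf(1) quot] .
        have "chief_condition ?Y g G N {\<one>\<^bsub>G\<^esub>}" using GLF c by (simp add: mem_LF_iff)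
        then have "G Mod centralizer G N {\<one>\<^bsub>G\<^esub>} \<in>\<^sub>c f (nat_copy ?Q)"
          using chief_factor_primes[OF fin c S(1) ab(2)[OF True]] Ecl_iff[OF Y] True
            g_prime[OF True cf(4) finQ cf(5) S(3)]
          by (simp add: chief_condition_def)
        then have "f_central L f G N {\<one>\<^bsub>G\<^esub>}"
          using Ecl_iff[OF assms(4)] True YL by (auto simp: f_central_def)
        then have "G \<in> F"
          using mem_CF_of_monolith[OF sat _ fin Q(2,3) min mono] Q(1) F by blast
        then show ?thesis using belongs_iff_mem[OF formation_group_class[OF form] is_group] by blast
      qed
    qed
  qed
  ultimately show ?thesis using form loc by (auto simp: local_formation_def)
qed

theorem theorem5p1:
  fixes F X L :: grp_class
  assumes "formation F" and "F \<noteq> {}"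
    and "simple_class X" and "char_primes X = primes_of_class X"
    and "simple_class L" and "abelian_part L = abelian_part X"
  shows "(local_formation X F \<longrightarrow> has_composition_satellite L F) \<and>
         (has_composition_satellite L F \<longrightarrow> local_formation (abelian_part X) F)"
  using local_formation_has_composition_satellite[OF assms(2-6)]
    composition_satellite_imp_local_formation[OF assms(2-6)] by blast

end
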